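(* Let $n\ge0$ and $p\ge2$ be integers, let $\mu$ be a partition with $\ell(\mu)\le 2n+1$, and let $\mathbf v=(v_1,v_2,\ldots)$ be commuting indeterminates. Let $H^{(2n+1)}_\mu=\bigl[h_{j-i-\mu_{2n+1-i+1}}\bigr]_{1\le i\le 2n+1,\ j\ge1}$, let $\Omega^{(p)}(\mathbf v)$ be the infinite skew-symmetric matrix (rows and columns indexed by $1,2,3,\ldots$) with $\Omega^{(p)}(\mathbf v)_{i,i+1}=v_i$, $\Omega^{(p)}(\mathbf v)_{i+1,i}=-v_i$ for $i\ge p$ and all other entries $0$, and set $$\widetilde H^{(2n+1)}_\mu=\begin{bmatrix}1&0\\0&H^{(2n+1)}_\mu\end{bmatrix},\qquad \widetilde\Omega^{(p)}(\mathbf v)=\begin{bmatrix}0&w_{p-1}\\-w_{p-1}^{\mathsf T}&\Omega^{(p)}(\mathbf v)\end{bmatrix},$$ where $w_{p-1}=(0,\dots,0,1,0,\dots)$ is the infinite row vector with $1$ in position $p-1$ and $0$ elsewhere. Then $$\operatorname{Pf}\left(\widetilde H^{(2n+1)}_\mu\,\widetilde\Omega^{(p)}(\mathbf v)\,\bigl(\widetilde H^{(2n+1)}_\mu\bigr)^{\mathsf T}\right)=\sum_{0\le a_1\le\cdots\le a_n}s_{\bigl((a_n+p-2)^2,\ldots,(a_1+p-2)^2,\,p-2\bigr)/\mu}\prod_{r=1}^n v_{a_r+p+2r-2},$$ where the sum is over all weakly increasing $n$-tuples of nonnegative integers.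
   Context: $h_k$ is the $k$-th complete homogeneous symmetric function, with $h_0=1$ and $h_k=0$ for $k<0$. $s_{\lambda/\mu}$ is the skew Schur function, with $s_{\lambda/\mu}=0$ if $\mu\not\subseteq\lambda$. $\mu_i$ is the $i$-th part of $\mu$ (zero for $i>\ell(\mu)$), $\ell(\mu)$ is the number of nonzero parts, and $a^2$ in a partition means the part $a$ repeated twice. The Pfaffian of a $2N\times2N$ skew-symmetric matrix $M$ is $\operatorname{Pf}(M)=\frac{1}{2^N N!}\sum_{\sigma\in\mathfrak S_{2N}}\mathrm{sgn}(\sigma)\prod_{i=1}^N M_{\sigma(2i-1),\sigma(2i)}$. All infinite sums (including those in the matrix product) are interpreted coefficientwise with respect to the usual grading of the ring of symmetric functions, i.e. in the degree completion of the ring of symmetric functions with coefficients in polynomials in $v_1,v_2,\ldots$; in each fixed degree only finitely many terms are nonzero. For $n=0$ the sum consists of the single term $s_{(p-2)/\mu}$. *)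

theory Defs
  imports Complex_Main "HOL-Library.Poly_Mapping" "HOL-Library.FuncSet" "HOL-Combinatorics.Permutations"
begin

section \<open>Formal power series in countably many variables\<close>

text \<open>
  A series in \<open>x\<^sub>0, x\<^sub>1, \<dots>\<close> is given by its coefficients, one for each monomial; a monomial
  is its finitely supported exponent vector.  The degree completion of the ring of symmetric
  functions over \<open>'a\<close> is the subring of symmetric series.
\<close>

typedef 'a mfps = "UNIV :: ((nat \<Rightarrow>\<^sub>0 nat) \<Rightarrow> 'a) set"
  morphisms mcoeff Mfps ..

setup_lifting type_definition_mfps

lemma mfps_eqI: "(\<And>m. mcoeff f m = mcoeff g m) \<Longrightarrow> f = g"
  by transfer auto

lemma mcoeff_Mfps [simp]: "mcoeff (Mfps f) = f"
  by (simp add: Mfps_inverse)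

definition splits :: "(nat \<Rightarrow>\<^sub>0 nat) \<Rightarrow> ((nat \<Rightarrow>\<^sub>0 nat) \<times> (nat \<Rightarrow>\<^sub>0 nat)) set" where
  "splits m = {(a, b). a + b = m}"

lemma finite_splits: "finite (splits m)"
proof -
  let ?F = "\<lambda>(a, b :: nat \<Rightarrow>\<^sub>0 nat). restrict (Poly_Mapping.lookup a) (Poly_Mapping.keys m)"
  have le: "Poly_Mapping.lookup a k \<le> Poly_Mapping.lookup m k" if "a + b = m" for a b :: "nat \<Rightarrow>\<^sub>0 nat" and k
    using that by (auto simp: lookup_add)
  have "inj_on ?F (splits m)"
  proof (rule inj_onI, clarify)
    fix a b c d :: "nat \<Rightarrow>\<^sub>0 nat"
    assume ab: "(a, b) \<in> splits m" and cd: "(c, d) \<in> splits m"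
      and eq: "restrict (Poly_Mapping.lookup a) (Poly_Mapping.keys m) = restrict (Poly_Mapping.lookup c) (Poly_Mapping.keys m)"
    have s: "a + b = m" "c + d = m"
      using ab cd by (auto simp: splits_def)
    have ac: "a = c"
    proof (rule poly_mapping_eqI)
      fix k
      show "Poly_Mapping.lookup a k = Poly_Mapping.lookup c k"
      proof (cases "k \<in> Poly_Mapping.keys m")
        case True
        then show ?thesis using fun_cong[OF eq, of k] by simp
      next
        case False
        then have "Poly_Mapping.lookup m k = 0" by (simp add: in_keys_iff)
        then show ?thesis using le[OF s(1), of k] le[OF s(2), of k] by simp
      qed
    qed
    moreover have "b = d" using s ac add_left_imp_eq by blast
    ultimately show "a = c \<and> b = d" by simp
  qed
  moreover have "?F ` splits m \<subseteq> (Poly_Mapping.keys m \<rightarrow>\<^sub>E {..Max (Poly_Mapping.lookup m ` Poly_Mapping.keys m)})"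
  proof (clarsimp simp: splits_def PiE_iff)
    fix a b :: "nat \<Rightarrow>\<^sub>0 nat" and k assume "k \<in> Poly_Mapping.keys (a + b)"
    moreover have "Poly_Mapping.lookup a k \<le> Poly_Mapping.lookup (a + b) k" by (simp add: lookup_add)
    ultimately show "Poly_Mapping.lookup a k \<le> Max (Poly_Mapping.lookup (a + b) ` Poly_Mapping.keys (a + b))"
      by (meson Max_ge finite_imageI finite_keys imageI order_trans)
  qed
  ultimately show ?thesis
    by (meson finite_PiE finite_atMost finite_keys finite_subset inj_on_finite)
qed

instantiation mfps :: (comm_ring_1) comm_ring_1
begin

lift_definition zero_mfps :: "'a mfps" is "\<lambda>_. 0" .
lift_definition one_mfps :: "'a mfps" is "\<lambda>m. if m = 0 then 1 else 0" .
lift_definition plus_mfps :: "'a mfps \<Rightarrow> 'a mfps \<Rightarrow> 'a mfps" is "\<lambda>f g m. f m + g m" .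
lift_definition minus_mfps :: "'a mfps \<Rightarrow> 'a mfps \<Rightarrow> 'a mfps" is "\<lambda>f g m. f m - g m" .
lift_definition uminus_mfps :: "'a mfps \<Rightarrow> 'a mfps" is "\<lambda>f m. - f m" .
lift_definition times_mfps :: "'a mfps \<Rightarrow> 'a mfps \<Rightarrow> 'a mfps"
  is "\<lambda>f g m. \<Sum>(a, b)\<in>splits m. f a * g b" .

instance
proof
  fix f g h :: "'a mfps"
  show "f * g * h = f * (g * h)"
  proof (rule mfps_eqI)
    fix m
    have "mcoeff (f * g * h) m =
        (\<Sum>p\<in>splits m. \<Sum>q\<in>splits (fst p). mcoeff f (fst q) * mcoeff g (snd q) * mcoeff h (snd p))"
      by (simp add: times_mfps.rep_eq case_prod_unfold sum_distrib_right)
    also have "\<dots> = (\<Sum>(p, q)\<in>Sigma (splits m) (\<lambda>p. splits (fst p)).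
        mcoeff f (fst q) * mcoeff g (snd q) * mcoeff h (snd p))"
      by (subst sum.Sigma) (auto simp: finite_splits)
    also have "\<dots> = (\<Sum>(p, q)\<in>Sigma (splits m) (\<lambda>p. splits (snd p)).
        mcoeff f (fst p) * (mcoeff g (fst q) * mcoeff h (snd q)))"
      by (rule sum.reindex_bij_witness
          [where j = "\<lambda>((a, c), (d, e)). ((d, e + c), (e, c))"
             and i = "\<lambda>((a, c), (d, e)). ((a + d, e), (a, d))"])
        (auto simp: splits_def ac_simps)
    also have "\<dots> = (\<Sum>p\<in>splits m. \<Sum>q\<in>splits (snd p). mcoeff f (fst p) * (mcoeff g (fst q) * mcoeff h (snd q)))"
      by (subst sum.Sigma) (auto simp: finite_splits)
    also have "\<dots> = mcoeff (f * (g * h)) m"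
      by (simp add: times_mfps.rep_eq case_prod_unfold sum_distrib_left)
    finally show "mcoeff (f * g * h) m = mcoeff (f * (g * h)) m" .
  qed
  show "f * g = g * f"
  proof (rule mfps_eqI)
    fix m
    show "mcoeff (f * g) m = mcoeff (g * f) m"
      unfolding times_mfps.rep_eq
      by (rule sum.reindex_bij_witness[where i = prod.swap and j = prod.swap])
        (auto simp: splits_def ac_simps)
  qed
  show "1 * f = f"
  proof (rule mfps_eqI)
    fix m
    have "mcoeff (1 * f) m = (\<Sum>p\<in>splits m. if p = (0, m) then mcoeff f m else 0)"
      unfolding times_mfps.rep_eq one_mfps.rep_eq
      by (rule sum.cong) (auto simp: splits_def split: if_splits)
    also have "\<dots> = mcoeff f m"
      by (subst sum.delta[OF finite_splits]) (auto simp: splits_def)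
    finally show "mcoeff (1 * f) m = mcoeff f m" .
  qed
  show "(f + g) * h = f * h + g * h"
    by (rule mfps_eqI)
      (simp add: times_mfps.rep_eq plus_mfps.rep_eq case_prod_unfold algebra_simps sum.distrib)
  show "(0 :: 'a mfps) \<noteq> 1"
    by transfer (metis zero_neq_one)
qed (transfer; simp add: fun_eq_iff algebra_simps)+

end

lift_definition mconst :: "'a::zero \<Rightarrow> 'a mfps" is "\<lambda>c m. if m = 0 then c else 0" .

text \<open>
  The coefficientwise sum of a family in which every monomial occurs only finitely often
  (other families are not meant to be summed).
\<close>

definition msum :: "('i \<Rightarrow> 'a::comm_monoid_add mfps) \<Rightarrow> 'i set \<Rightarrow> 'a mfps" where
  "msum f A = Mfps (\<lambda>m. \<Sum>i | i \<in> A \<and> mcoeff (f i) m \<noteq> 0. mcoeff (f i) m)"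

definition mdeg :: "(nat \<Rightarrow>\<^sub>0 nat) \<Rightarrow> nat" where
  "mdeg m = (\<Sum>i\<in>Poly_Mapping.keys m. Poly_Mapping.lookup m i)"


section \<open>The ground ring\<close>

text \<open>
  Polynomials in \<open>v\<^sub>0, v\<^sub>1, \<dots>\<close> with rational coefficients; the rationals provide the factor
  \<open>1 / (2 ^ N * fact N)\<close> of the Pfaffian.
\<close>

type_synonym vpoly = "(nat \<Rightarrow>\<^sub>0 nat) \<Rightarrow>\<^sub>0 rat"

definition vvar :: "nat \<Rightarrow> vpoly mfps" where
  "vvar i = mconst (Poly_Mapping.single (Poly_Mapping.single i 1) 1)"

definition rat_const :: "rat \<Rightarrow> vpoly mfps" where
  "rat_const c = mconst (Poly_Mapping.single 0 c)"


section \<open>Partitions and symmetric functions\<close>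

text \<open>Partitions are weakly decreasing lists; trailing zeros are allowed and immaterial.\<close>

definition is_partition :: "nat list \<Rightarrow> bool" where
  "is_partition la \<longleftrightarrow> sorted_wrt (\<ge>) la"

definition part :: "nat list \<Rightarrow> nat \<Rightarrow> nat" where
  "part la i = (if 1 \<le> i \<and> i \<le> length la then la ! (i - 1) else 0)"

definition plen :: "nat list \<Rightarrow> nat" where
  "plen la = card {i. part la i \<noteq> 0}"

definition skew_diagram :: "nat list \<Rightarrow> nat list \<Rightarrow> (nat \<times> nat) set" where
  "skew_diagram la mu = {(i, j). part mu i < j \<and> j \<le> part la i}"

text \<open>Semistandard tableaux; entry \<open>k\<close> stands for the variable \<open>x\<^sub>k\<close>, so entries start at 0.\<close>

definition ssyt :: "nat list \<Rightarrow> nat list \<Rightarrow> (nat \<times> nat \<Rightarrow> nat) set" where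
  "ssyt la mu = {T \<in> skew_diagram la mu \<rightarrow>\<^sub>E UNIV.
     (\<forall>i j j'. (i, j) \<in> skew_diagram la mu \<and> (i, j') \<in> skew_diagram la mu \<and> j < j'
        \<longrightarrow> T (i, j) \<le> T (i, j')) \<and>
     (\<forall>i i' j. (i, j) \<in> skew_diagram la mu \<and> (i', j) \<in> skew_diagram la mu \<and> i < i'
        \<longrightarrow> T (i, j) < T (i', j))}"

definition skew_schur :: "nat list \<Rightarrow> nat list \<Rightarrow> 'a::comm_ring_1 mfps" where
  "skew_schur la mu =
     (if \<forall>i. part mu i \<le> part la i
      then Mfps (\<lambda>m. of_nat (card {T \<in> ssyt la mu.
             \<forall>k. card {c \<in> skew_diagram la mu. T c = k} = Poly_Mapping.lookup m k}))
      else 0)"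

text \<open>\<open>h\<^sub>k\<close> is the sum of all monomials of degree \<open>k\<close>; there are none for \<open>k < 0\<close>.\<close>

definition hsym :: "int \<Rightarrow> 'a::comm_ring_1 mfps" where
  "hsym k = Mfps (\<lambda>m. if int (mdeg m) = k then 1 else 0)"


section \<open>Infinite matrices and the Pfaffian\<close>

text \<open>Rows and columns of all matrices are numbered from 1; other entries are irrelevant.\<close>

type_synonym 'a imat = "nat \<Rightarrow> nat \<Rightarrow> 'a"

definition imat_mult :: "'a::comm_ring_1 mfps imat \<Rightarrow> 'a mfps imat \<Rightarrow> 'a mfps imat" where
  "imat_mult A B = (\<lambda>i j. msum (\<lambda>k. A i k * B k j) {1..})"

definition imat_transpose :: "'a imat \<Rightarrow> 'a imat" where
  "imat_transpose A = (\<lambda>i j. A j i)"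

text \<open>The block matrix with first row \<open>(d, r)\<close>, first column \<open>(d, c)\<close> and remainder \<open>B\<close>.\<close>

definition bordered :: "'a \<Rightarrow> (nat \<Rightarrow> 'a) \<Rightarrow> (nat \<Rightarrow> 'a) \<Rightarrow> 'a imat \<Rightarrow> 'a imat" where
  "bordered d r c B = (\<lambda>i j.
     if i = 1 then (if j = 1 then d else r (j - 1))
     else (if j = 1 then c (i - 1) else B (i - 1) (j - 1)))"

definition Pf :: "nat \<Rightarrow> vpoly mfps imat \<Rightarrow> vpoly mfps" where
  "Pf N M = rat_const (1 / (2 ^ N * fact N)) *
     (\<Sum>\<sigma> | \<sigma> permutes {1..2 * N}.
        of_int (sign \<sigma>) * (\<Prod>i = 1..N. M (\<sigma> (2 * i - 1)) (\<sigma> (2 * i))))"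

text \<open>\<open>Hmat l mu\<close> has \<open>l\<close> rows.\<close>

definition Hmat :: "nat \<Rightarrow> nat list \<Rightarrow> vpoly mfps imat" where
  "Hmat l mu = (\<lambda>i j. hsym (int j - int i - int (part mu (l + 1 - i))))"

definition Omega :: "nat \<Rightarrow> vpoly mfps imat" where
  "Omega p = (\<lambda>i j. if p \<le> i \<and> j = i + 1 then vvar i
                    else if p \<le> j \<and> i = j + 1 then - vvar j
                    else 0)"

definition Htilde :: "nat \<Rightarrow> nat list \<Rightarrow> vpoly mfps imat" where
  "Htilde l mu = bordered 1 (\<lambda>_. 0) (\<lambda>_. 0) (Hmat l mu)"

definition wvec :: "nat \<Rightarrow> nat \<Rightarrow> vpoly mfps" where
  "wvec q = (\<lambda>j. if j = q then 1 else 0)"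

definition Omega_tilde :: "nat \<Rightarrow> vpoly mfps imat" where
  "Omega_tilde p = bordered 0 (wvec (p - 1)) (\<lambda>i. - wvec (p - 1) i) (Omega p)"

text \<open>For \<open>a = [a\<^sub>1, \<dots>, a\<^sub>n]\<close> the partition with each \<open>a\<^sub>r + p - 2\<close> twice, in reverse order, and
  a final part \<open>p - 2\<close>.\<close>

definition doubled_shape :: "nat \<Rightarrow> nat list \<Rightarrow> nat list" where
  "doubled_shape p a = concat (map (\<lambda>x. [x + p - 2, x + p - 2]) (rev a)) @ [p - 2]"


section \<open>All sums in the theorem are locally finite\<close>

lemma mdeg_add: "mdeg (a + b) = mdeg a + mdeg b"
proof -
  let ?K = "Poly_Mapping.keys a \<union> Poly_Mapping.keys b"
  have *: "mdeg c = (\<Sum>i\<in>?K. Poly_Mapping.lookup c i)"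
    if "Poly_Mapping.keys c \<subseteq> ?K" for c
    unfolding mdeg_def using that by (intro sum.mono_neutral_left) (auto simp: in_keys_iff)
  show ?thesis
    using Poly_Mapping.keys_add[of a b]
    by (simp add: *[of "a + b"] *[of a] *[of b] lookup_add sum.distrib)
qed

lemma mcoeff_mult_nonzeroD:
  assumes "mcoeff (f * g) m \<noteq> 0"
  shows "\<exists>a b. a + b = m \<and> mcoeff f a \<noteq> 0 \<and> mcoeff g b \<noteq> 0"
proof (rule ccontr)
  assume "\<not> ?thesis"
  then have "\<forall>p\<in>splits m. mcoeff f (fst p) * mcoeff g (snd p) = 0"
    unfolding splits_def by force
  then have "mcoeff (f * g) m = 0"
    by (simp add: times_mfps.rep_eq case_prod_unfold)
  with assms show False by simp
qed

lemma finite_Htilde_Omega_tilde: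
  "finite {k \<in> {1..}. mcoeff (Htilde l mu i k * Omega_tilde p k j) m \<noteq> 0}"
proof (rule finite_subset)
  show "{k \<in> {1..}. mcoeff (Htilde l mu i k * Omega_tilde p k j) m \<noteq> 0} \<subseteq> {..p + j + 2}"
    by (auto simp: Omega_tilde_def bordered_def wvec_def Omega_def zero_mfps.rep_eq split: if_splits)
qed simp

lemma finite_Htilde_Omega_tilde_Htilde:
  "finite {k \<in> {1..}. mcoeff (imat_mult (Htilde l mu) (Omega_tilde p) i k *
                                imat_transpose (Htilde l mu) k j) m \<noteq> 0}"
proof (rule finite_subset)
  show "{k \<in> {1..}. mcoeff (imat_mult (Htilde l mu) (Omega_tilde p) i k *
                             imat_transpose (Htilde l mu) k j) m \<noteq> 0}
        \<subseteq> {..mdeg m + j + part mu (l + 1 - (j - 1)) + 1}"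
  proof
    fix k
    assume "k \<in> {k \<in> {1..}. mcoeff (imat_mult (Htilde l mu) (Omega_tilde p) i k *
                    imat_transpose (Htilde l mu) k j) m \<noteq> 0}"
    then have "mcoeff (imat_mult (Htilde l mu) (Omega_tilde p) i k *
                       imat_transpose (Htilde l mu) k j) m \<noteq> 0" by simp
    then obtain a b where ab: "a + b = m" and "mcoeff (Htilde l mu j k) b \<noteq> 0"
      unfolding imat_transpose_def using mcoeff_mult_nonzeroD by metis
    then have "k \<le> mdeg b + j + part mu (l + 1 - (j - 1)) + 1"
      by (auto simp: Htilde_def bordered_def Hmat_def hsym_def zero_mfps.rep_eq split: if_splits)
    with ab show "k \<in> {..mdeg m + j + part mu (l + 1 - (j - 1)) + 1}"
      by (auto simp: mdeg_add)
  qed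
qed simp

lemma finite_skew_diagram: "finite (skew_diagram la mu)"
proof (rule finite_subset)
  show "skew_diagram la mu \<subseteq> {..length la} \<times> {..Max (set la)}"
  proof (clarsimp simp: skew_diagram_def)
    fix i j assume "part mu i < j" "j \<le> part la i"
    then have "1 \<le> i" "i \<le> length la" "j \<le> la ! (i - 1)"
      by (auto simp: part_def split: if_splits)
    moreover from this have "la ! (i - 1) \<le> Max (set la)"
      by (intro Max_ge nth_mem) auto
    ultimately show "i \<le> length la \<and> j \<le> Max (set la)" by linarith
  qed
qed simp

text \<open>Skew Schur functions are homogeneous.\<close>

lemma skew_schur_degree:
  assumes "mcoeff (skew_schur la mu :: 'a::comm_ring_1 mfps) m \<noteq> 0"
  shows "mdeg m = card (skew_diagram la mu)"
proof -
  let ?D = "skew_diagram la mu"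
  have "{T \<in> ssyt la mu. \<forall>k. card {c \<in> ?D. T c = k} = Poly_Mapping.lookup m k} \<noteq> {}"
  proof
    assume "{T \<in> ssyt la mu. \<forall>k. card {c \<in> ?D. T c = k} = Poly_Mapping.lookup m k} = {}"
    then have "mcoeff (skew_schur la mu :: 'a mfps) m = 0"
      by (simp add: skew_schur_def zero_mfps.rep_eq del: Collect_empty_eq)
    with assms show False by simp
  qed
  then obtain T where T: "\<And>k. card {c \<in> ?D. T c = k} = Poly_Mapping.lookup m k"
    by blast
  have "T c \<in> Poly_Mapping.keys m" if "c \<in> ?D" for c
  proof -
    have "c \<in> {d \<in> ?D. T d = T c}" using that by simp
    then have "card {d \<in> ?D. T d = T c} > 0"
      using finite_skew_diagram card_gt_0_iff by fastforce
    then show ?thesis by (simp add: T in_keys_iff)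
  qed
  then have D: "?D = (\<Union>k\<in>Poly_Mapping.keys m. {c \<in> ?D. T c = k})" by auto
  have "card (\<Union>k\<in>Poly_Mapping.keys m. {c \<in> ?D. T c = k}) =
      (\<Sum>k\<in>Poly_Mapping.keys m. card {c \<in> ?D. T c = k})"
    by (rule card_UN_disjoint) (auto simp: finite_skew_diagram)
  then have "card ?D = (\<Sum>k\<in>Poly_Mapping.keys m. card {c \<in> ?D. T c = k})"
    by (simp only: D[symmetric])
  also have "\<dots> = mdeg m"
    unfolding mdeg_def by (rule sum.cong) (auto simp only: T)
  finally show ?thesis by (rule sym)
qed

lemma finite_skew_schur_sum:
  assumes "2 \<le> p"
  shows "finite {a \<in> {a. length a = n \<and> sorted a}.
    mcoeff (skew_schur (doubled_shape p a) mu *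
            (\<Prod>r = 1..n. vvar (a ! (r - 1) + p + 2 * r - 2))) m \<noteq> 0}"
proof (rule finite_subset)
  let ?B = "mdeg m + part mu 1"
  show "{a \<in> {a. length a = n \<and> sorted a}.
    mcoeff (skew_schur (doubled_shape p a) mu *
            (\<Prod>r = 1..n. vvar (a ! (r - 1) + p + 2 * r - 2))) m \<noteq> 0}
    \<subseteq> {a. set a \<subseteq> {..?B} \<and> length a = n}"
  proof
    fix a
    assume "a \<in> {a \<in> {a. length a = n \<and> sorted a}.
      mcoeff (skew_schur (doubled_shape p a) mu *
              (\<Prod>r = 1..n. vvar (a ! (r - 1) + p + 2 * r - 2))) m \<noteq> 0}"
    then have len: "length a = n" and sa: "sorted a"
      and nz: "mcoeff (skew_schur (doubled_shape p a) mu *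
              (\<Prod>r = 1..n. vvar (a ! (r - 1) + p + 2 * r - 2))) m \<noteq> 0"
      by blast+
    obtain b c where bc: "b + c = m"
      and b: "mcoeff (skew_schur (doubled_shape p a) mu :: vpoly mfps) b \<noteq> 0"
      using mcoeff_mult_nonzeroD[OF nz] by blast
    have deg: "card (skew_diagram (doubled_shape p a) mu) \<le> mdeg m"
      using skew_schur_degree[OF b] mdeg_add[of b c] bc by simp
    have "x \<le> ?B" if x: "x \<in> set a" for x
    proof -
      obtain a' y where a: "a = a' @ [y]" using x by (cases a rule: rev_cases) auto
      have xy: "x \<le> y" using sa x by (auto simp: a sorted_append)
      have "part (doubled_shape p a) 1 = y + p - 2"
        by (simp add: part_def doubled_shape_def a)
      then have "Pair 1 ` {part mu 1<..y + p - 2} \<subseteq> skew_diagram (doubled_shape p a) mu"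
        by (auto simp: skew_diagram_def)
      then have "card (Pair (1::nat) ` {part mu 1<..y + p - 2}) \<le> mdeg m"
        by (rule order_trans[OF card_mono[OF finite_skew_diagram] deg])
      moreover have "card (Pair (1::nat) ` {part mu 1<..y + p - 2}) = y + p - 2 - part mu 1"
        by (subst card_image) (simp_all add: inj_on_def)
      ultimately show ?thesis using xy assms by linarith
    qed
    then show "a \<in> {a. set a \<subseteq> {..?B} \<and> length a = n}"
      using len by auto
  qed
  show "finite {a. set a \<subseteq> {..?B} \<and> length a = n}"
    by (rule finite_lists_length_eq) simp
qed

end

theory Submission
  imports Defs
begin

text \<open>
  Write \<open>H\<close> for \<open>Htilde (2 * n + 1) mu\<close>.  The matrix \<open>Omega_tilde p\<close> is the skew-symmetric adjacency
  matrix of a weighted graph on the column indices: one edge joins 1 and \<open>p\<close>, and an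
  edge of weight \<open>v\<^bsub>t-1\<^esub>\<close> joins \<open>t\<close> and \<open>t + 1\<close> for each \<open>t > p\<close>.
  Expanding the Pfaffian of \<open>H * Omega_tilde p * H\<^sup>T\<close> multilinearly gives a sum over sets of \<open>n + 1\<close>
  edges: the product of their weights times the minor of \<open>H\<close> on the columns that they meet
  (\<open>Pf_minor_sum\<close>).  This minor vanishes unless the edges are disjoint, and also unless they include the
  edge from 1 to \<open>p\<close>, since the first row of \<open>H\<close> is the first unit vector (\<open>minor_eq_0\<close>).  The
  remaining edges are \<open>n\<close> disjoint pairs of consecutive numbers, and subtracting the forced gaps turns
  them into weakly increasing sequences \<open>a\<close> (\<open>edge_seq_bij\<close>).  The columns chosen by \<open>a\<close>, diminished by
  their positions, are the parts of the doubled shape, so the minor is the Jacobi-Trudi determinant of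
  the skew Schur function (\<open>minor_edge_seq\<close>).

  The Jacobi-Trudi identity (\<open>jacobi_trudi\<close>) is proved for \<open>K\<close> variables by induction on \<open>K\<close>.
  Tableaux satisfy the branching rule that removes the cells with the largest entry, a horizontal strip
  (\<open>schur_vars_Suc\<close>).  The determinant satisfies the same recursion after one round of column operations
  (\<open>jacobi_trudi_Suc\<close>).

  All infinite sums are handled one coefficient at a time: the coefficient at a monomial \<open>m\<close> is
  unaffected by changes of the factors at monomials that do not divide \<open>m\<close> (\<open>agree\<close>).
\<close>

section \<open>Coefficientwise congruence\<close>

text \<open>
  Equality of the coefficients at all divisors of a fixed monomial \<open>m\<close>.  Closure under divisors makes
  this a ring congruence, so inside any polynomial expression an infinite sum may be truncated and
  \<open>h\<^sub>k\<close> may be replaced by its finite-variable version before the coefficient at \<open>m\<close> is read off.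
\<close>

definition agree :: "(nat \<Rightarrow>\<^sub>0 nat) \<Rightarrow> 'a::comm_ring_1 mfps \<Rightarrow> 'a mfps \<Rightarrow> bool" where
  "agree m f g \<longleftrightarrow> (\<forall>a b. a + b = m \<longrightarrow> mcoeff f a = mcoeff g a)"

lemma agree_refl [simp]: "agree m f f"
  by (simp add: agree_def)

lemma agree_mcoeff: "agree m f g \<Longrightarrow> mcoeff f m = mcoeff g m"
  by (simp add: agree_def)

lemma agree_trans: "agree m f g \<Longrightarrow> agree m g h \<Longrightarrow> agree m f h"
  by (simp add: agree_def)

lemma agree_add: "agree m f f' \<Longrightarrow> agree m g g' \<Longrightarrow> agree m (f + g) (f' + g')"
  by (simp add: agree_def plus_mfps.rep_eq)

lemma agree_mult:
  assumes "agree m f f'" "agree m g g'"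
  shows "agree m (f * g) (f' * g')"
  unfolding agree_def
proof (intro allI impI)
  fix a b assume ab: "a + b = m"
  have "mcoeff f c * mcoeff g d = mcoeff f' c * mcoeff g' d" if "(c, d) \<in> splits a" for c d
  proof -
    have "c + (d + b) = m" "d + (c + b) = m"
      using that ab by (auto simp: splits_def ac_simps)
    then show ?thesis using assms unfolding agree_def by metis
  qed
  then show "mcoeff (f * g) a = mcoeff (f' * g') a"
    unfolding times_mfps.rep_eq by (intro sum.cong) auto
qed

lemma agree_sum: "(\<And>i. i \<in> I \<Longrightarrow> agree m (f i) (g i)) \<Longrightarrow> agree m (sum f I) (sum g I)"
  by (induction I rule: infinite_finite_induct) (auto intro: agree_add)

lemma agree_prod: "(\<And>i. i \<in> I \<Longrightarrow> agree m (f i) (g i)) \<Longrightarrow> agree m (prod f I) (prod g I)"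
  by (induction I rule: infinite_finite_induct) (auto intro: agree_mult)

lemma mcoeff_sum: "mcoeff (sum f I) m = (\<Sum>i\<in>I. mcoeff (f i) m)"
  by (induction I rule: infinite_finite_induct)
    (auto simp: zero_mfps.rep_eq plus_mfps.rep_eq)

lemma mcoeff_msum:
  assumes "finite B" "B \<subseteq> A" "\<And>i. i \<in> A \<Longrightarrow> mcoeff (f i) m \<noteq> 0 \<Longrightarrow> i \<in> B"
  shows "mcoeff (msum f A) m = (\<Sum>i\<in>B. mcoeff (f i) m)"
proof -
  have "mcoeff (msum f A) m = (\<Sum>i | i \<in> A \<and> mcoeff (f i) m \<noteq> 0. mcoeff (f i) m)"
    by (simp add: msum_def)
  also have "\<dots> = (\<Sum>i\<in>B. mcoeff (f i) m)"
    by (rule sum.mono_neutral_left) (use assms in auto)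
  finally show ?thesis .
qed

lemma agree_msum:
  assumes "finite B" "B \<subseteq> A" "\<And>i. i \<in> A - B \<Longrightarrow> agree m (f i) 0"
  shows "agree m (msum f A) (sum f B)"
  unfolding agree_def
proof (intro allI impI)
  fix a b assume ab: "a + b = m"
  have "mcoeff (f i) a = 0" if "i \<in> A - B" for i
    using assms(3)[OF that] ab by (auto simp: agree_def zero_mfps.rep_eq)
  then have "mcoeff (msum f A) a = (\<Sum>i\<in>B. mcoeff (f i) a)"
    by (intro mcoeff_msum assms(1,2)) auto
  then show "mcoeff (msum f A) a = mcoeff (sum f B) a" by (simp add: mcoeff_sum)
qed

section \<open>Determinants over finite index sets\<close>

text \<open>
  The Leibniz determinant with rows and columns indexed by an arbitrary finite set.  The determinants
  below live on \<open>{1..2 * N}\<close>, on this set without its first element and on \<open>{1..N}\<close>, and it is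
  convenient to pass between them by \<open>ldet_unit_corner\<close> and \<open>ldet_reindex\<close>.
\<close>

definition ldet :: "'i set \<Rightarrow> ('i \<Rightarrow> 'i \<Rightarrow> 'a::comm_ring_1) \<Rightarrow> 'a" where
  "ldet S A = (\<Sum>\<sigma> | \<sigma> permutes S. of_int (sign \<sigma>) * (\<Prod>c\<in>S. A (\<sigma> c) c))"

lemma ldet_cong:
  assumes "\<And>r c. r \<in> S \<Longrightarrow> c \<in> S \<Longrightarrow> A r c = B r c"
  shows "ldet S A = ldet S B"
  unfolding ldet_def
proof (rule sum.cong, simp)
  fix \<sigma> assume "\<sigma> \<in> {\<sigma>. \<sigma> permutes S}"
  then have "(\<Prod>c\<in>S. A (\<sigma> c) c) = (\<Prod>c\<in>S. B (\<sigma> c) c)"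
    by (intro prod.cong refl assms) (auto simp: permutes_in_image)
  then show "of_int (sign \<sigma>) * (\<Prod>c\<in>S. A (\<sigma> c) c) = of_int (sign \<sigma>) * (\<Prod>c\<in>S. B (\<sigma> c) c)"
    by simp
qed

lemma agree_ldet:
  assumes "\<And>r c. r \<in> S \<Longrightarrow> c \<in> S \<Longrightarrow> agree m (A r c) (B r c)"
  shows "agree m (ldet S A) (ldet S B)"
  unfolding ldet_def
  by (intro agree_sum agree_mult agree_prod agree_refl assms) (auto simp: permutes_in_image)

lemma ldet_permute_columns:
  assumes \<pi>: "\<pi> permutes S" and S: "finite S"
  shows "ldet S (\<lambda>r c. A r (\<pi> c)) = of_int (sign \<pi>) * ldet S A"
proof -
  have "ldet S (\<lambda>r c. A r (\<pi> c)) =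
      (\<Sum>\<sigma> | \<sigma> permutes S. of_int (sign (\<sigma> \<circ> \<pi>)) * (\<Prod>c\<in>S. A (\<sigma> (\<pi> c)) (\<pi> c)))"
    unfolding ldet_def by (subst sum_permutations_compose_right[OF \<pi>]) simp
  also have "\<dots> = (\<Sum>\<sigma> | \<sigma> permutes S. of_int (sign \<pi>) * (of_int (sign \<sigma>) * (\<Prod>c\<in>S. A (\<sigma> c) c)))"
  proof (rule sum.cong, simp)
    fix \<sigma> assume "\<sigma> \<in> {\<sigma>. \<sigma> permutes S}"
    then have "sign (\<sigma> \<circ> \<pi>) = sign \<sigma> * sign \<pi>"
      using \<pi> S by (intro sign_compose) (auto intro: permutes_imp_permutation)
    moreover have "(\<Prod>c\<in>S. A (\<sigma> (\<pi> c)) (\<pi> c)) = (\<Prod>c\<in>S. A (\<sigma> c) c)"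
      using prod.permute[OF \<pi>, of "\<lambda>c. A (\<sigma> c) c"] by (simp add: o_def)
    ultimately show "of_int (sign (\<sigma> \<circ> \<pi>)) * (\<Prod>c\<in>S. A (\<sigma> (\<pi> c)) (\<pi> c)) =
        of_int (sign \<pi>) * (of_int (sign \<sigma>) * (\<Prod>c\<in>S. A (\<sigma> c) c))"
      by (simp add: ac_simps)
  qed
  finally show ?thesis by (simp add: ldet_def sum_distrib_left)
qed

text \<open>
  Composition with the transposition of the two columns pairs the even with the odd permutations and
  flips the sign.  Unlike a deduction from antisymmetry, this works in every characteristic.
\<close>

lemma ldet_equal_columns:
  assumes S: "finite S" and ij: "i \<in> S" "j \<in> S" "i \<noteq> j" and eq: "\<And>r. r \<in> S \<Longrightarrow> A r i = A r j"
  shows "ldet S A = 0"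
proof -
  let ?\<tau> = "transpose i j"
  let ?f = "\<lambda>\<sigma>. of_int (sign \<sigma>) * (\<Prod>c\<in>S. A (\<sigma> c) c)"
  let ?E = "{\<sigma>. \<sigma> permutes S \<and> evenperm \<sigma>}" and ?O = "{\<sigma>. \<sigma> permutes S \<and> \<not> evenperm \<sigma>}"
  have \<tau>: "?\<tau> permutes S" using ij by (simp add: permutes_swap_id)
  have swap: "evenperm (\<sigma> \<circ> ?\<tau>) \<longleftrightarrow> \<not> evenperm \<sigma>" if "\<sigma> permutes S" for \<sigma>
    using that S ij
    by (subst evenperm_comp) (auto simp: evenperm_swap permutation_swap_id intro: permutes_imp_permutation)
  have neg: "?f (\<sigma> \<circ> ?\<tau>) = - ?f \<sigma>" if \<sigma>: "\<sigma> permutes S" for \<sigma>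
  proof -
    have "(\<Prod>c\<in>S. A (\<sigma> (?\<tau> c)) c) = (\<Prod>c\<in>S. A (\<sigma> (?\<tau> c)) (?\<tau> c))"
      using \<sigma> ij eq by (intro prod.cong refl) (auto simp: transpose_def permutes_in_image)
    also have "\<dots> = (\<Prod>c\<in>S. A (\<sigma> c) c)"
      using prod.permute[OF \<tau>, of "\<lambda>c. A (\<sigma> c) c"] by (simp add: o_def)
    finally show ?thesis using swap[OF \<sigma>] by (simp add: sign_def)
  qed
  have "{\<sigma>. \<sigma> permutes S} = ?E \<union> ?O" "?E \<inter> ?O = {}" by auto
  then have "ldet S A = sum ?f ?E + sum ?f ?O"
    unfolding ldet_def using finite_permutations[OF S]
    by (metis (no_types, lifting) finite_Un sum.union_disjoint)
  also have "sum ?f ?O = (\<Sum>\<sigma>\<in>?E. ?f (\<sigma> \<circ> ?\<tau>))"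
    by (rule sum.reindex_bij_witness[where i = "\<lambda>\<sigma>. \<sigma> \<circ> ?\<tau>" and j = "\<lambda>\<sigma>. \<sigma> \<circ> ?\<tau>"])
      (auto simp: swap permutes_compose[OF \<tau>] comp_assoc)
  also have "\<dots> = (\<Sum>\<sigma>\<in>?E. - ?f \<sigma>)"
    by (rule sum.cong) (use neg in auto)
  finally show ?thesis by (simp add: sum_negf)
qed

lemma ldet_zero_column:
  assumes "finite S" "k \<in> S" "\<And>r. r \<in> S \<Longrightarrow> A r k = 0"
  shows "ldet S A = 0"
  unfolding ldet_def
proof (rule sum.neutral, clarify)
  fix \<sigma> assume "\<sigma> permutes S"
  then have "A (\<sigma> k) k = 0" using assms by (simp add: permutes_in_image)
  then have "(\<Prod>c\<in>S. A (\<sigma> c) c) = 0" using assms by (intro prod_zero) auto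
  then show "of_int (sign \<sigma>) * (\<Prod>c\<in>S. A (\<sigma> c) c) = 0" by simp
qed

lemma ldet_zero_row:
  assumes "finite S" "k \<in> S" "\<And>c. c \<in> S \<Longrightarrow> A k c = 0"
  shows "ldet S A = 0"
  unfolding ldet_def
proof (rule sum.neutral, clarify)
  fix \<sigma> assume \<sigma>: "\<sigma> permutes S"
  then obtain c where "c \<in> S" "\<sigma> c = k" using assms(2) by (metis permutes_image imageE)
  then have "(\<Prod>c\<in>S. A (\<sigma> c) c) = 0" using assms by (intro prod_zero) auto
  then show "of_int (sign \<sigma>) * (\<Prod>c\<in>S. A (\<sigma> c) c) = 0" by simp
qed

lemma ldet_reindex:
  assumes f: "bij_betw f S T" and S: "finite S"
  shows "ldet T A = ldet S (\<lambda>r c. A (f r) (f c))"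
proof -
  have inj: "inj_on f S" using f by (rule bij_betw_imp_inj_on)
  have "bij_betw (map_permutation S f) {\<sigma>. \<sigma> permutes S} {\<sigma>. \<sigma> permutes T}"
    using bij_betw_permutations[OF f] bij_betw_imp_surj_on[OF f]
    by (simp add: map_permutation_def[abs_def] restrict_id_def[abs_def] o_def)
  then have "ldet T A = (\<Sum>\<sigma> | \<sigma> permutes S. of_int (sign (map_permutation S f \<sigma>)) *
      (\<Prod>c\<in>T. A (map_permutation S f \<sigma> c) c))"
    unfolding ldet_def by (rule sum.reindex_bij_betw[symmetric])
  also have "\<dots> = ldet S (\<lambda>r c. A (f r) (f c))"
    unfolding ldet_def
  proof (rule sum.cong, simp)
    fix \<sigma> assume "\<sigma> \<in> {\<sigma>. \<sigma> permutes S}"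
    then have \<sigma>: "\<sigma> permutes S" by simp
    have "(\<Prod>c\<in>T. A (map_permutation S f \<sigma> c) c) = (\<Prod>c\<in>S. A (map_permutation S f \<sigma> (f c)) (f c))"
      by (rule prod.reindex_bij_betw[OF f, symmetric])
    also have "\<dots> = (\<Prod>c\<in>S. A (f (\<sigma> c)) (f c))"
      using inj by (intro prod.cong) (auto simp: map_permutation_apply)
    finally show "of_int (sign (map_permutation S f \<sigma>)) * (\<Prod>c\<in>T. A (map_permutation S f \<sigma> c) c) =
        of_int (sign \<sigma>) * (\<Prod>c\<in>S. A (f (\<sigma> c)) (f c))"
      using sign_map_permutation[OF inj \<sigma> S] by simp
  qed
  finally show ?thesis .
qed

lemma ldet_unit_corner:
  assumes S: "finite S" and k: "k \<in> S" and one: "A k k = 1"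
    and col: "\<And>r. r \<in> S \<Longrightarrow> r \<noteq> k \<Longrightarrow> A r k = 0"
  shows "ldet S A = ldet (S - {k}) A"
  unfolding ldet_def
proof (rule sum.mono_neutral_cong_right)
  show "{\<sigma>. \<sigma> permutes S - {k}} \<subseteq> {\<sigma>. \<sigma> permutes S}"
    by (auto intro: permutes_subset)
  show "\<forall>\<sigma>\<in>{\<sigma>. \<sigma> permutes S} - {\<sigma>. \<sigma> permutes S - {k}}.
      of_int (sign \<sigma>) * (\<Prod>c\<in>S. A (\<sigma> c) c) = 0"
  proof
    fix \<sigma> assume "\<sigma> \<in> {\<sigma>. \<sigma> permutes S} - {\<sigma>. \<sigma> permutes S - {k}}"
    then have \<sigma>: "\<sigma> permutes S" "\<not> \<sigma> permutes S - {k}" by auto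
    then have "\<sigma> k \<noteq> k" using permutes_superset[OF \<sigma>(1), of "S - {k}"] by auto
    then have "A (\<sigma> k) k = 0" using col \<sigma> k by (simp add: permutes_in_image)
    then have "(\<Prod>c\<in>S. A (\<sigma> c) c) = 0" using S k by (intro prod_zero) auto
    then show "of_int (sign \<sigma>) * (\<Prod>c\<in>S. A (\<sigma> c) c) = 0" by simp
  qed
  fix \<sigma> assume "\<sigma> \<in> {\<sigma>. \<sigma> permutes S - {k}}"
  then have "\<sigma> k = k" by (auto simp: permutes_not_in)
  then show "of_int (sign \<sigma>) * (\<Prod>c\<in>S. A (\<sigma> c) c) = of_int (sign \<sigma>) * (\<Prod>c\<in>S - {k}. A (\<sigma> c) c)"
    using S k one by (simp add: prod.remove[of S k])
qed (simp add: finite_permutations S)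

lemma ldet_sum_columns:
  assumes S: "finite S" and Q: "\<And>c. c \<in> S \<Longrightarrow> finite (Q c)"
  shows "ldet S (\<lambda>r c. \<Sum>q\<in>Q c. w c q * A r c q) =
    (\<Sum>f\<in>PiE S Q. (\<Prod>c\<in>S. w c (f c)) * ldet S (\<lambda>r c. A r c (f c)))"
proof -
  have "ldet S (\<lambda>r c. \<Sum>q\<in>Q c. w c q * A r c q) =
      (\<Sum>\<sigma> | \<sigma> permutes S. \<Sum>f\<in>PiE S Q. of_int (sign \<sigma>) * (\<Prod>c\<in>S. w c (f c) * A (\<sigma> c) c (f c)))"
    unfolding ldet_def by (simp add: prod_sum_PiE[OF S Q] sum_distrib_left)
  also have "\<dots> =
      (\<Sum>f\<in>PiE S Q. \<Sum>\<sigma> | \<sigma> permutes S. of_int (sign \<sigma>) * (\<Prod>c\<in>S. w c (f c) * A (\<sigma> c) c (f c)))"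
    by (rule sum.swap)
  also have "\<dots> = (\<Sum>f\<in>PiE S Q. (\<Prod>c\<in>S. w c (f c)) * ldet S (\<lambda>r c. A r c (f c)))"
    by (simp add: ldet_def sum_distrib_left prod.distrib mult.left_commute)
  finally show ?thesis .
qed

lemma ldet_column_linear:
  assumes S: "finite S" and k: "k \<in> S"
  shows "ldet S (\<lambda>r c. if c = k then u r - t * v r else A r c) =
    ldet S (\<lambda>r c. if c = k then u r else A r c) - t * ldet S (\<lambda>r c. if c = k then v r else A r c)"
  unfolding ldet_def
  by (simp add: prod.remove[OF S k] sum_subtractf sum_distrib_left algebra_simps)

text \<open>
  The columns are treated from left to right, so column \<open>Suc c\<close> is still the original one when a
  multiple of it is subtracted from column \<open>c\<close>; the last column is changed only by a zero column.
\<close>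

lemma ldet_subtract_next_column:
  fixes A :: "nat \<Rightarrow> nat \<Rightarrow> 'a::comm_ring_1"
  assumes last: "\<And>r. r \<in> {1..N} \<Longrightarrow> A r (Suc N) = 0"
  shows "ldet {1..N} (\<lambda>r c. A r c - t c * A r (Suc c)) = ldet {1..N} A"
proof -
  define D where "D k = (\<lambda>r c. if c \<le> k then A r c - t c * A r (Suc c) else A r c)" for k
  have step: "ldet {1..N} (D (Suc k)) = ldet {1..N} (D k)" if "Suc k \<le> N" for k
  proof -
    have "ldet {1..N} (D (Suc k)) =
        ldet {1..N} (\<lambda>r c. if c = Suc k then A r (Suc k) - t (Suc k) * A r (Suc (Suc k)) else D k r c)"
      by (rule ldet_cong) (auto simp: D_def)
    also have "\<dots> = ldet {1..N} (\<lambda>r c. if c = Suc k then A r (Suc k) else D k r c)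
        - t (Suc k) * ldet {1..N} (\<lambda>r c. if c = Suc k then A r (Suc (Suc k)) else D k r c)"
      by (rule ldet_column_linear) (use that in auto)
    also have "ldet {1..N} (\<lambda>r c. if c = Suc k then A r (Suc (Suc k)) else D k r c) = 0"
    proof (cases "Suc k = N")
      case True
      then show ?thesis using last that by (intro ldet_zero_column[of _ "Suc k"]) auto
    next
      case False
      then show ?thesis using that
        by (intro ldet_equal_columns[of _ "Suc k" "Suc (Suc k)"]) (auto simp: D_def)
    qed
    also have "ldet {1..N} (\<lambda>r c. if c = Suc k then A r (Suc k) else D k r c) = ldet {1..N} (D k)"
      by (rule ldet_cong) (auto simp: D_def)
    finally show ?thesis by simp
  qed
  have "ldet {1..N} (D k) = ldet {1..N} (D 0)" if "k \<le> N" for k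
    using that by (induction k) (auto simp: step simp del: One_nat_def)
  from this[of N] have "ldet {1..N} (D N) = ldet {1..N} (D 0)" by simp
  moreover have "ldet {1..N} (D N) = ldet {1..N} (\<lambda>r c. A r c - t c * A r (Suc c))"
    by (rule ldet_cong) (auto simp: D_def)
  moreover have "ldet {1..N} (D 0) = ldet {1..N} A"
    by (rule ldet_cong) (auto simp: D_def)
  ultimately show ?thesis by simp
qed

section \<open>Symmetric functions in finitely many variables\<close>

definition mvar :: "nat \<Rightarrow> 'a::comm_ring_1 mfps" where
  "mvar k = Mfps (\<lambda>m. if m = Poly_Mapping.single k 1 then 1 else 0)"

text \<open>
  The complete homogeneous function of degree \<open>k\<close> in the variables \<open>x\<^sub>0, \<dots>, x\<^bsub>K-1\<^esub>\<close>.
\<close>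

definition hvars :: "nat \<Rightarrow> int \<Rightarrow> 'a::comm_ring_1 mfps" where
  "hvars K k = Mfps (\<lambda>m. if Poly_Mapping.keys m \<subseteq> {..<K} \<and> int (mdeg m) = k then 1 else 0)"

lemma mcoeff_mvar_mult:
  "mcoeff (mvar k * f) m =
    (if Poly_Mapping.lookup m k > 0 then mcoeff f (m - Poly_Mapping.single k 1) else 0)"
proof (cases "Poly_Mapping.lookup m k > 0")
  case True
  let ?s = "Poly_Mapping.single k (1::nat)"
  have m: "?s + (m - ?s) = m"
    using True by (intro poly_mapping_eqI) (auto simp: lookup_add lookup_minus lookup_single when_def)
  have "mcoeff (mvar k * f) m = (\<Sum>q\<in>splits m. if q = (?s, m - ?s) then mcoeff f (m - ?s) else 0)"
    unfolding times_mfps.rep_eq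
    by (rule sum.cong) (auto simp: splits_def mvar_def split: if_splits)
  also have "\<dots> = mcoeff f (m - ?s)"
    by (subst sum.delta[OF finite_splits]) (use m in \<open>auto simp: splits_def\<close>)
  finally show ?thesis using True by simp
next
  case False
  have "a \<noteq> Poly_Mapping.single k 1" if "(a, b) \<in> splits m" for a b
    using that False by (auto simp: splits_def lookup_add)
  then have "mcoeff (mvar k * f) m = 0"
    unfolding times_mfps.rep_eq by (intro sum.neutral) (auto simp: mvar_def)
  with False show ?thesis by simp
qed

text \<open>
  A monomial either avoids \<open>x\<^sub>K\<close> or is divisible by it.
\<close>

lemma hvars_Suc: "hvars (Suc K) k = hvars K k + mvar K * hvars (Suc K) (k - 1)"
proof (rule mfps_eqI)
  fix m
  let ?s = "Poly_Mapping.single K (1::nat)"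
  show "mcoeff (hvars (Suc K) k :: 'a mfps) m = mcoeff (hvars K k + mvar K * hvars (Suc K) (k - 1)) m"
  proof (cases "Poly_Mapping.lookup m K > 0")
    case True
    then have m: "?s + (m - ?s) = m"
      by (intro poly_mapping_eqI) (auto simp: lookup_add lookup_minus lookup_single when_def)
    have K: "K \<in> Poly_Mapping.keys m" using True by (simp add: in_keys_iff)
    have "mdeg ?s = 1" by (simp add: mdeg_def)
    then have "mdeg m = 1 + mdeg (m - ?s)" using mdeg_add[of ?s "m - ?s"] m by simp
    moreover have "Poly_Mapping.keys (m - ?s) \<subseteq> {..<Suc K} \<longleftrightarrow> Poly_Mapping.keys m \<subseteq> {..<Suc K}"
    proof -
      have "x \<in> Poly_Mapping.keys (m - ?s) \<longleftrightarrow> x \<in> Poly_Mapping.keys m" if "x \<noteq> K" for x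
        using that by (simp add: in_keys_iff lookup_minus lookup_single)
      then have "Poly_Mapping.keys (m - ?s) - {K} = Poly_Mapping.keys m - {K}" by blast
      moreover have "X \<subseteq> {..<Suc K} \<longleftrightarrow> X - {K} \<subseteq> {..<Suc K}" for X by auto
      ultimately show ?thesis by metis
    qed
    moreover have "\<not> Poly_Mapping.keys m \<subseteq> {..<K}" using K by auto
    ultimately show ?thesis
      using True by (auto simp: plus_mfps.rep_eq mcoeff_mvar_mult hvars_def)
  next
    case False
    then have "K \<notin> Poly_Mapping.keys m" by (simp add: in_keys_iff)
    then have "Poly_Mapping.keys m \<subseteq> {..<Suc K} \<longleftrightarrow> Poly_Mapping.keys m \<subseteq> {..<K}"
      by (auto simp: less_Suc_eq)
    with False show ?thesis
      by (simp add: plus_mfps.rep_eq mcoeff_mvar_mult hvars_def)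
  qed
qed

lemma hvars_neg: "k < 0 \<Longrightarrow> hvars K k = 0"
  by (rule mfps_eqI) (simp add: hvars_def zero_mfps.rep_eq)

lemma hvars_0: "hvars 0 k = (if k = 0 then 1 else 0)"
  by (rule mfps_eqI) (auto simp: hvars_def zero_mfps.rep_eq one_mfps.rep_eq mdeg_def)

text \<open>
  The iterate of \<open>hvars_Suc\<close>: subtracting \<open>x\<^sub>K\<^sup>d\<close> times a lower homogeneous function leaves exactly the
  monomials whose exponent of \<open>x\<^sub>K\<close> is less than \<open>d\<close>.  This bound on the exponent is what turns the
  column operation in the Jacobi-Trudi determinant into the horizontal strip condition.
\<close>

lemma hvars_diff:
  "(hvars (Suc K) k :: 'a::comm_ring_1 mfps) - mvar K ^ d * hvars (Suc K) (k - int d) =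
    (\<Sum>j<d. mvar K ^ j * hvars K (k - int j))"
proof (induction d)
  case (Suc d)
  have "(hvars (Suc K) k :: 'a mfps) - mvar K ^ Suc d * hvars (Suc K) (k - int (Suc d)) =
      (hvars (Suc K) k - mvar K ^ d * hvars (Suc K) (k - int d))
      + mvar K ^ d * (hvars (Suc K) (k - int d) - mvar K * hvars (Suc K) (k - int d - 1))"
    by (simp add: algebra_simps)
  also have "(hvars (Suc K) (k - int d) :: 'a mfps) - mvar K * hvars (Suc K) (k - int d - 1) =
      hvars K (k - int d)"
    unfolding hvars_Suc[of K "k - int d"] by simp
  finally show ?case using Suc by simp
qed simp

lemma agree_hsym_hvars:
  assumes "Poly_Mapping.keys m \<subseteq> {..<K}"
  shows "agree m (hsym k) (hvars K k)"
  unfolding agree_def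
proof (intro allI impI)
  fix a b assume "a + b = m"
  then have "Poly_Mapping.keys a \<subseteq> Poly_Mapping.keys m" by (auto simp: in_keys_iff lookup_add)
  then show "mcoeff (hsym k) a = mcoeff (hvars K k) a"
    using assms by (auto simp: hsym_def hvars_def)
qed

section \<open>Tableaux\<close>

text \<open>
  Partitions with at most \<open>N\<close> parts as functions; the parts are numbered from 1, as in \<open>part\<close>, and
  position 0 carries the default value 0.
\<close>

definition shape :: "nat \<Rightarrow> (nat \<Rightarrow> nat) \<Rightarrow> bool" where
  "shape N lam \<longleftrightarrow> lam 0 = 0 \<and> (\<forall>i\<ge>1. lam (Suc i) \<le> lam i) \<and> (\<forall>i>N. lam i = 0)"

definition cells :: "(nat \<Rightarrow> nat) \<Rightarrow> (nat \<Rightarrow> nat) \<Rightarrow> (nat \<times> nat) set" where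
  "cells lam mu = {(i, j). mu i < j \<and> j \<le> lam i}"

text \<open>
  The same tableaux as in \<open>ssyt\<close>, but for shapes given as functions and with entries below \<open>K\<close>, so that
  there are only finitely many and their weights can be summed in the ring.
\<close>

definition fillings :: "nat \<Rightarrow> (nat \<Rightarrow> nat) \<Rightarrow> (nat \<Rightarrow> nat) \<Rightarrow> (nat \<times> nat \<Rightarrow> nat) set" where
  "fillings K lam mu = {T \<in> cells lam mu \<rightarrow>\<^sub>E {..<K}.
     (\<forall>i j j'. (i, j) \<in> cells lam mu \<and> (i, j') \<in> cells lam mu \<and> j < j' \<longrightarrow> T (i, j) \<le> T (i, j')) \<and>
     (\<forall>i i' j. (i, j) \<in> cells lam mu \<and> (i', j) \<in> cells lam mu \<and> i < i' \<longrightarrow> T (i, j) < T (i', j))}"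

definition schur_vars :: "nat \<Rightarrow> (nat \<Rightarrow> nat) \<Rightarrow> (nat \<Rightarrow> nat) \<Rightarrow> 'a::comm_ring_1 mfps" where
  "schur_vars K lam mu = (if \<forall>i. mu i \<le> lam i
     then \<Sum>T\<in>fillings K lam mu. \<Prod>c\<in>cells lam mu. mvar (T c) else 0)"

text \<open>
  The shapes \<open>nu\<close> for which \<open>lam / nu\<close> is a horizontal strip.
\<close>

definition strips :: "nat \<Rightarrow> (nat \<Rightarrow> nat) \<Rightarrow> (nat \<Rightarrow> nat) set" where
  "strips N lam = {nu. \<forall>i. if i \<in> {1..N} then lam (Suc i) \<le> nu i \<and> nu i \<le> lam i else nu i = 0}"

lemma shape_antimono:
  assumes "shape N lam" "1 \<le> i" "i \<le> j"
  shows "lam j \<le> lam i"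
  using assms(3)
proof (induction j rule: dec_induct)
  case (step j)
  then have "lam (Suc j) \<le> lam j" using assms by (auto simp: shape_def)
  then show ?case using step by simp
qed simp

lemma shape_outside: "shape N lam \<Longrightarrow> i \<notin> {1..N} \<Longrightarrow> lam i = 0"
  by (cases i) (auto simp: shape_def)

lemma cells_Sigma:
  assumes "shape N lam"
  shows "cells lam mu = (SIGMA i:{1..N}. {mu i<..lam i})"
  using shape_outside[OF assms] by (fastforce simp: cells_def)

lemma finite_cells: "shape N lam \<Longrightarrow> finite (cells lam mu)"
  by (simp add: cells_Sigma)

lemma finite_fillings: "shape N lam \<Longrightarrow> finite (fillings K lam mu)"
  unfolding fillings_def
  by (rule finite_subset[of _ "cells lam mu \<rightarrow>\<^sub>E {..<K}"]) (auto intro: finite_PiE finite_cells)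

lemma strips_le:
  assumes "shape N lam" "nu \<in> strips N lam"
  shows "nu i \<le> lam i"
  using assms by (cases "i \<in> {1..N}") (auto simp: strips_def)

lemma strips_interlace:
  assumes "shape N lam" "nu \<in> strips N lam" "1 \<le> i"
  shows "lam (Suc i) \<le> nu i"
proof (cases "i \<le> N")
  case True
  then show ?thesis using assms by (auto simp: strips_def dest!: spec[of _ i])
next
  case False
  then show ?thesis using assms by (simp add: shape_def)
qed

lemma strips_shape:
  assumes "shape N lam" "nu \<in> strips N lam"
  shows "shape N nu"
  unfolding shape_def
proof (intro conjI allI impI)
  show "nu 0 = 0" "\<And>i. N < i \<Longrightarrow> nu i = 0" using assms(2) by (auto simp: strips_def)
  fix i :: nat assume "1 \<le> i"
  then show "nu (Suc i) \<le> nu i"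
    using strips_le[OF assms, of "Suc i"] strips_interlace[OF assms, of i] by linarith
qed

lemma strips_PiE:
  assumes "shape N lam"
  shows "bij_betw (\<lambda>f i. if i \<in> {1..N} then f i else 0) (PiE {1..N} (\<lambda>c. {lam (Suc c)..lam c})) (strips N lam)"
  by (rule bij_betwI[where g = "\<lambda>nu. restrict nu {1..N}"])
    (auto simp: strips_def PiE_iff fun_eq_iff extensional_def)

lemma finite_strips: "shape N lam \<Longrightarrow> finite (strips N lam)"
  using bij_betw_finite[OF strips_PiE] by (simp add: finite_PiE)

lemma fillings_rowD:
  "T \<in> fillings K lam mu \<Longrightarrow> (i, j) \<in> cells lam mu \<Longrightarrow> (i, j') \<in> cells lam mu \<Longrightarrow> j \<le> j' \<Longrightarrow>
    T (i, j) \<le> T (i, j')"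
  by (cases "j = j'") (auto simp: fillings_def)

lemma fillings_colD:
  "T \<in> fillings K lam mu \<Longrightarrow> (i, j) \<in> cells lam mu \<Longrightarrow> (i', j) \<in> cells lam mu \<Longrightarrow> i < i' \<Longrightarrow>
    T (i, j) < T (i', j)"
  by (auto simp: fillings_def)

lemma fillings_boundD: "T \<in> fillings K lam mu \<Longrightarrow> c \<in> cells lam mu \<Longrightarrow> T c < K"
  by (auto simp: fillings_def PiE_iff)

text \<open>
  The shape occupied by the inner boundary \<open>mu\<close> and the entries of \<open>T\<close> below \<open>K\<close>.  As rows increase
  weakly, these entries form an initial segment of each row, ending at the maximum taken here.
\<close>

definition inner_shape :: "nat \<Rightarrow> nat \<Rightarrow> (nat \<Rightarrow> nat) \<Rightarrow> (nat \<Rightarrow> nat) \<Rightarrow> (nat \<times> nat \<Rightarrow> nat) \<Rightarrow> nat \<Rightarrow> nat" where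
  "inner_shape N K lam mu T = (\<lambda>i. if i \<in> {1..N}
     then Max (insert (mu i) {j. (i, j) \<in> cells lam mu \<and> T (i, j) < K}) else 0)"

lemma finite_row: "finite {j. (i, j) \<in> cells lam mu \<and> P j}"
  by (rule finite_subset[of _ "{..lam i}"]) (auto simp: cells_def)

lemma inner_shape_iff:
  assumes lam: "shape N lam" and T: "T \<in> fillings (Suc K) lam mu" and ij: "(i, j) \<in> cells lam mu"
  shows "j \<le> inner_shape N K lam mu T i \<longleftrightarrow> T (i, j) < K"
proof -
  let ?R = "{j. (i, j) \<in> cells lam mu \<and> T (i, j) < K}"
  have i: "i \<in> {1..N}" using ij cells_Sigma[OF lam] by auto
  have fin: "finite (insert (mu i) ?R)" by (simp add: finite_row)
  show ?thesis
  proof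
    assume "T (i, j) < K"
    then show "j \<le> inner_shape N K lam mu T i"
      using ij i fin by (auto simp: inner_shape_def intro!: Max_ge)
  next
    assume j: "j \<le> inner_shape N K lam mu T i"
    have "Max (insert (mu i) ?R) \<in> insert (mu i) ?R" by (rule Max_in[OF fin]) simp
    moreover have "mu i < inner_shape N K lam mu T i" using j ij by (auto simp: cells_def)
    ultimately have "(i, inner_shape N K lam mu T i) \<in> cells lam mu" "T (i, inner_shape N K lam mu T i) < K"
      using i by (auto simp: inner_shape_def)
    then show "T (i, j) < K" using fillings_rowD[OF T ij] j by fastforce
  qed
qed

lemma inner_shape_bounds:
  assumes lam: "shape N lam" and le: "\<And>i. mu i \<le> lam i"
  shows "mu i \<le> inner_shape N K lam mu T i" "inner_shape N K lam mu T i \<le> lam i"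
proof -
  let ?R = "{j. (i, j) \<in> cells lam mu \<and> T (i, j) < K}"
  have "mu i \<le> inner_shape N K lam mu T i \<and> inner_shape N K lam mu T i \<le> lam i"
  proof (cases "i \<in> {1..N}")
    case True
    have "finite (insert (mu i) ?R)" by (simp add: finite_row)
    then show ?thesis using True le by (auto simp: inner_shape_def cells_def intro!: Max_ge)
  next
    case False
    have "mu i = 0" "lam i = 0" using le[of i] shape_outside[OF lam False] by auto
    then show ?thesis unfolding inner_shape_def if_not_P[OF False] by simp
  qed
  then show "mu i \<le> inner_shape N K lam mu T i" "inner_shape N K lam mu T i \<le> lam i" by auto
qed

text \<open>
  If a cell \<open>(i, lam (Suc i))\<close> above the end of the next row lies in the skew shape, then its entry is
  less than the entry below it, hence less than the largest possible entry \<open>K\<close>.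
\<close>

lemma inner_shape_strip:
  assumes lam: "shape N lam" and mu: "\<forall>i\<ge>1. mu (Suc i) \<le> mu i"
    and le: "\<And>i. mu i \<le> lam i" and T: "T \<in> fillings (Suc K) lam mu"
  shows "inner_shape N K lam mu T \<in> strips N lam"
proof -
  have "lam (Suc i) \<le> inner_shape N K lam mu T i" if i: "i \<in> {1..N}" for i
  proof (cases "lam (Suc i) \<le> mu i")
    case True
    then show ?thesis using inner_shape_bounds(1)[OF lam le, of i K T] by linarith
  next
    case False
    have "mu (Suc i) \<le> mu i" "lam (Suc i) \<le> lam i" using mu lam i by (auto simp: shape_def)
    then have c: "(Suc i, lam (Suc i)) \<in> cells lam mu" "(i, lam (Suc i)) \<in> cells lam mu"
      using False by (auto simp: cells_def)
    then have "T (i, lam (Suc i)) < T (Suc i, lam (Suc i))" using fillings_colD[OF T] by blast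
    moreover have "T (Suc i, lam (Suc i)) < Suc K" using fillings_boundD[OF T c(1)] .
    ultimately show ?thesis using inner_shape_iff[OF lam T c(2)] by linarith
  qed
  moreover have "inner_shape N K lam mu T i = 0" if "i \<notin> {1..N}" for i
    unfolding inner_shape_def if_not_P[OF that] ..
  ultimately show ?thesis
    using inner_shape_bounds(2)[OF lam le] unfolding strips_def by auto
qed

text \<open>
  The branching rule: the entries \<open>K\<close> of a tableau with entries at most \<open>K\<close> form a horizontal strip
  \<open>lam / nu\<close>, and what remains is an arbitrary tableau of shape \<open>nu / mu\<close> with entries below \<open>K\<close>.  In the
  other direction, filling a horizontal strip with \<open>K\<close> keeps the columns strict because two cells of
  the strip never lie in the same column.
\<close>

lemma sum_fillings_Suc:
  fixes mu lam :: "nat \<Rightarrow> nat"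
  assumes lam: "shape N lam" and mu: "\<forall>i\<ge>1. mu (Suc i) \<le> mu i"
    and le: "\<And>i. mu i \<le> lam i"
  shows "(\<Sum>T\<in>fillings (Suc K) lam mu. \<Prod>c\<in>cells lam mu. mvar (T c)) =
    (\<Sum>(nu, T)\<in>(SIGMA nu:{nu \<in> strips N lam. \<forall>i. mu i \<le> nu i}. fillings K nu mu).
       (\<Prod>c\<in>cells lam nu. mvar K) * (\<Prod>c\<in>cells nu mu. (mvar (T c) :: 'a::comm_ring_1 mfps)))"
proof (rule sum.reindex_bij_witness[where
      j = "\<lambda>T. (inner_shape N K lam mu T, restrict T (cells (inner_shape N K lam mu T) mu))" and
      i = "\<lambda>(nu, T) c. if c \<in> cells nu mu then T c else if c \<in> cells lam mu then K else undefined"],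
    goal_cases)
  case (1 T)
  have "T c = K" if "c \<in> cells lam mu" "c \<notin> cells (inner_shape N K lam mu T) mu" for c
    using that inner_shape_iff[OF lam 1, of "fst c" "snd c"] fillings_boundD[OF 1 that(1)]
    by (auto simp: cells_def)
  moreover have "T \<in> cells lam mu \<rightarrow>\<^sub>E {..<Suc K}" using 1 by (simp add: fillings_def)
  then have "T c = undefined" if "c \<notin> cells lam mu" for c using that by (rule PiE_arb)
  moreover have "c \<in> cells lam mu" if "c \<in> cells (inner_shape N K lam mu T) mu" for c
    using that inner_shape_bounds(2)[OF lam le] by (auto simp: cells_def intro: order_trans)
  ultimately show ?case by (auto simp: fun_eq_iff)
next
  case (2 T)
  let ?nu = "inner_shape N K lam mu T"
  have sub: "c \<in> cells lam mu" if "c \<in> cells ?nu mu" for c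
    using that inner_shape_bounds(2)[OF lam le] by (auto simp: cells_def intro: order_trans)
  have "T c < K" if "c \<in> cells ?nu mu" for c
    using inner_shape_iff[OF lam 2, of "fst c" "snd c"] sub[OF that] that by (auto simp: cells_def)
  then have "restrict T (cells ?nu mu) \<in> fillings K ?nu mu"
    using fillings_rowD[OF 2] fillings_colD[OF 2] sub by (auto simp: fillings_def less_imp_le)
  then show ?case using inner_shape_strip[OF lam mu le 2] inner_shape_bounds(1)[OF lam le] by auto
next
  case (3 q)
  then obtain nu T where q: "q = (nu, T)" "nu \<in> strips N lam" "\<And>i. mu i \<le> nu i" "T \<in> fillings K nu mu"
    by auto
  let ?U = "\<lambda>c. if c \<in> cells nu mu then T c else if c \<in> cells lam mu then K else undefined"
  have out: "nu i = 0" if "i \<notin> {1..N}" for i using that q(2) by (simp add: strips_def)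
  have "inner_shape N K lam mu ?U i = nu i" for i
  proof (cases "i \<in> {1..N}")
    case True
    have "{j. (i, j) \<in> cells lam mu \<and> ?U (i, j) < K} = {mu i<..nu i}"
      using fillings_boundD[OF q(4)] strips_le[OF lam q(2), of i]
      by (auto simp: cells_def split: if_splits)
    then have "inner_shape N K lam mu ?U i = Max (insert (mu i) {mu i<..nu i})"
      using True by (simp add: inner_shape_def)
    also have "insert (mu i) {mu i<..nu i} = {mu i..nu i}" using q(3)[of i] by auto
    also have "Max \<dots> = nu i" using q(3) by (intro Max_eqI) auto
    finally show ?thesis .
  next
    case False
    then show ?thesis unfolding inner_shape_def if_not_P[OF False] using out by simp
  qed
  then have "inner_shape N K lam mu ?U = nu" by blast
  moreover have "restrict ?U (cells nu mu) = T"
    using q(4) by (auto simp: fillings_def PiE_iff extensional_def fun_eq_iff)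
  ultimately show ?case by (simp add: q(1))
next
  case (4 q)
  then obtain nu T where q: "q = (nu, T)" "nu \<in> strips N lam" "\<And>i. mu i \<le> nu i" "T \<in> fillings K nu mu"
    by auto
  let ?U = "\<lambda>c. if c \<in> cells nu mu then T c else if c \<in> cells lam mu then K else undefined"
  have sub: "c \<in> cells lam mu" if "c \<in> cells nu mu" for c
    using that strips_le[OF lam q(2)] by (auto simp: cells_def intro: order_trans)
  have lt: "T c < K" if "c \<in> cells nu mu" for c using that by (rule fillings_boundD[OF q(4)])
  have "?U \<in> fillings (Suc K) lam mu"
    unfolding fillings_def
  proof (intro CollectI conjI allI impI)
    show "?U \<in> cells lam mu \<rightarrow>\<^sub>E {..<Suc K}"
      using sub lt by (auto simp: PiE_iff extensional_def less_Suc_eq)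
  next
    fix i j j'
    assume c: "(i, j) \<in> cells lam mu \<and> (i, j') \<in> cells lam mu \<and> j < j'"
    then have "(i, j) \<in> cells nu mu" if "(i, j') \<in> cells nu mu"
      using that by (auto simp: cells_def)
    then show "?U (i, j) \<le> ?U (i, j')"
      using c fillings_rowD[OF q(4), of i j j'] lt[of "(i, j)"] by auto
  next
    fix i i' j
    assume c: "(i, j) \<in> cells lam mu \<and> (i', j) \<in> cells lam mu \<and> i < i'"
    have i: "1 \<le> i" using c cells_Sigma[OF lam] by auto
    have "j \<le> lam (Suc i)"
      using c shape_antimono[OF lam, of "Suc i" i'] by (auto simp: cells_def)
    also have "\<dots> \<le> nu i" by (rule strips_interlace[OF lam q(2) i])
    finally have "(i, j) \<in> cells nu mu" using c by (auto simp: cells_def)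
    then show "?U (i, j) < ?U (i', j)"
      using c fillings_colD[OF q(4), of i j i'] lt[of "(i, j)"] by auto
  qed
  then show ?case by (simp add: q(1))
next
  case (5 T)
  let ?nu = "inner_shape N K lam mu T"
  have U: "cells lam mu = cells lam ?nu \<union> cells ?nu mu" "cells lam ?nu \<inter> cells ?nu mu = {}"
    using inner_shape_bounds[OF lam le, where K = K and T = T] by (auto simp: cells_def intro: order_trans le_less_trans)
  have "finite (cells lam ?nu)" "finite (cells ?nu mu)"
    using finite_cells[OF lam, of mu] U(1) by (metis finite_Un)+
  then have "(\<Prod>c\<in>cells lam mu. mvar (T c) :: 'a mfps) =
      (\<Prod>c\<in>cells lam ?nu. mvar (T c)) * (\<Prod>c\<in>cells ?nu mu. mvar (T c))"
    by (subst U(1), intro prod.union_disjoint U(2))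
  also have "(\<Prod>c\<in>cells lam ?nu. mvar (T c) :: 'a mfps) = (\<Prod>c\<in>cells lam ?nu. mvar K)"
  proof (rule prod.cong, simp)
    fix c assume c: "c \<in> cells lam ?nu"
    then have c': "c \<in> cells lam mu" using U(1) by auto
    have "\<not> T c < K" using c inner_shape_iff[OF lam 5, of "fst c" "snd c"] c' by (auto simp: cells_def)
    then have "T c = K" using fillings_boundD[OF 5 c'] by simp
    then show "(mvar (T c) :: 'a mfps) = mvar K" by simp
  qed
  finally show ?case by simp
qed

lemma schur_vars_Suc:
  assumes lam: "shape N lam" and mu: "\<forall>i\<ge>1. mu (Suc i) \<le> mu i"
  shows "schur_vars (Suc K) lam mu =
    (\<Sum>nu\<in>strips N lam. (\<Prod>i\<in>{1..N}. mvar K ^ (lam i - nu i)) * schur_vars K nu mu)"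
proof (cases "\<forall>i. mu i \<le> lam i")
  case True
  have w: "(\<Prod>c\<in>cells lam nu. mvar K) = (\<Prod>i\<in>{1..N}. mvar K ^ (lam i - nu i))" for nu
    by (simp add: cells_Sigma[OF lam] prod.Sigma[symmetric] power_sum)
  let ?S = "{nu \<in> strips N lam. \<forall>i. mu i \<le> nu i}"
  have "schur_vars (Suc K) lam mu = (\<Sum>nu\<in>?S. \<Sum>T\<in>fillings K nu mu.
      (\<Prod>i\<in>{1..N}. mvar K ^ (lam i - nu i)) * (\<Prod>c\<in>cells nu mu. mvar (T c)))"
    using True unfolding schur_vars_def
    by (simp only: if_True sum_fillings_Suc[OF lam mu] w simp_thms)
      (subst sum.Sigma, auto simp: finite_strips[OF lam] intro: finite_fillings[OF strips_shape[OF lam]])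
  also have "\<dots> = (\<Sum>nu\<in>?S. (\<Prod>i\<in>{1..N}. mvar K ^ (lam i - nu i)) * schur_vars K nu mu)"
    by (rule sum.cong) (simp_all add: schur_vars_def sum_distrib_left)
  also have "\<dots> = (\<Sum>nu\<in>strips N lam. (\<Prod>i\<in>{1..N}. mvar K ^ (lam i - nu i)) * schur_vars K nu mu)"
    by (rule sum.mono_neutral_left) (auto simp: finite_strips[OF lam] schur_vars_def)
  finally show ?thesis .
next
  case False
  then have "\<not> (\<forall>i. mu i \<le> nu i)" if "nu \<in> strips N lam" for nu
    using strips_le[OF lam that] order_trans by blast
  then have "schur_vars K nu mu = (0 :: 'a mfps)" if "nu \<in> strips N lam" for nu
    unfolding schur_vars_def using that by (simp only: if_False simp_thms)
  moreover have "schur_vars (Suc K) lam mu = (0 :: 'a mfps)"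
    using False unfolding schur_vars_def by (rule if_not_P)
  ultimately show ?thesis by simp
qed

lemma schur_vars_0:
  assumes "shape N lam"
  shows "schur_vars 0 lam mu = (if lam = mu then 1 else 0)"
proof (cases "\<forall>i. mu i \<le> lam i")
  case le: True
  show ?thesis
  proof (cases "cells lam mu = {}")
    case True
    then have "(i, lam i) \<notin> cells lam mu" for i by simp
    then have "lam i \<le> mu i" for i by (simp add: cells_def not_less)
    then have "lam = mu" using le by (intro ext antisym) auto
    with True le show ?thesis by (simp add: schur_vars_def fillings_def)
  next
    case False
    then have "lam \<noteq> mu" by (auto simp: cells_def)
    moreover have "fillings 0 lam mu = {}" using False by (auto simp: fillings_def PiE_eq_empty_iff)
    ultimately show ?thesis by (simp add: schur_vars_def)
  qed
next
  case False
  then show ?thesis by (auto simp: schur_vars_def)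
qed

section \<open>The Jacobi-Trudi identity\<close>

text \<open>
  Without variables \<open>h\<^sub>k\<close> is 1 or 0 according as \<open>k = 0\<close> or not.  Both \<open>lam c - c\<close> and \<open>mu r - r\<close> are
  strictly decreasing, so a permutation matching them is increasing, hence the identity.
\<close>

lemma jacobi_trudi_0:
  assumes lam: "shape N lam" and mu: "shape N mu"
  shows "ldet {1..N} (\<lambda>r c. hvars 0 (int (lam c) - int c - int (mu r) + int r)) =
    (if lam = mu then 1 else (0 :: 'a::comm_ring_1 mfps))"
proof -
  let ?A = "\<lambda>r c. hvars 0 (int (lam c) - int c - int (mu r) + int r) :: 'a mfps"
  have id: "\<sigma> = id" if \<sigma>: "\<sigma> permutes {1..N}" and nz: "(\<Prod>c\<in>{1..N}. ?A (\<sigma> c) c) \<noteq> 0" for \<sigma>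
  proof -
    have eq: "int (lam c) - int c = int (mu (\<sigma> c)) - int (\<sigma> c)" if "c \<in> {1..N}" for c
    proof -
      have "?A (\<sigma> c) c \<noteq> 0"
      proof
        assume "?A (\<sigma> c) c = 0"
        then have "(\<Prod>c\<in>{1..N}. ?A (\<sigma> c) c) = 0" using that by (intro prod_zero) auto
        with nz show False by contradiction
      qed
      then show ?thesis by (auto simp: hvars_0 split: if_splits)
    qed
    have less: "\<sigma> c < \<sigma> d" if "c \<in> {1..N}" "d \<in> {1..N}" "c < d" for c d
    proof (rule ccontr)
      assume "\<not> \<sigma> c < \<sigma> d"
      moreover have "1 \<le> \<sigma> d" using that permutes_in_image[OF \<sigma>, of d] by auto
      ultimately have "mu (\<sigma> c) \<le> mu (\<sigma> d)" using shape_antimono[OF mu, of "\<sigma> d" "\<sigma> c"] by simp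
      moreover have "lam d \<le> lam c" using shape_antimono[OF lam, of c d] that by simp
      ultimately show False using eq[OF that(1)] eq[OF that(2)] \<open>\<not> \<sigma> c < \<sigma> d\<close> that(3) by linarith
    qed
    have "c \<le> \<sigma> c" if "c \<le> N" for c
      using that
    proof (induction c)
      case (Suc c)
      then show ?case
        using less[of c "Suc c"] permutes_in_image[OF \<sigma>, of 1] by (cases "c = 0") auto
    qed simp
    then show ?thesis by (intro permutes_natset_ge[OF \<sigma>]) auto
  qed
  have "ldet {1..N} ?A = (\<Sum>\<sigma>\<in>{id}. of_int (sign \<sigma>) * (\<Prod>c\<in>{1..N}. ?A (\<sigma> c) c))"
    unfolding ldet_def
  proof (rule sum.mono_neutral_right)
    show "\<forall>\<sigma>\<in>{\<sigma>. \<sigma> permutes {1..N}} - {id}. of_int (sign \<sigma>) * (\<Prod>c\<in>{1..N}. ?A (\<sigma> c) c) = 0"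
    proof
      fix \<sigma> assume "\<sigma> \<in> {\<sigma>. \<sigma> permutes {1..N}} - {id}"
      then have "(\<Prod>c\<in>{1..N}. ?A (\<sigma> c) c) = 0" using id[of \<sigma>] by blast
      then show "of_int (sign \<sigma>) * (\<Prod>c\<in>{1..N}. ?A (\<sigma> c) c) = 0" by simp
    qed
  qed (auto simp: finite_permutations permutes_id)
  also have "\<dots> = (\<Prod>c\<in>{1..N}. if lam c = mu c then 1 else 0)"
    by (simp add: hvars_0 cong: prod.cong)
  also have "\<dots> = (if lam = mu then 1 else 0)"
  proof (cases "lam = mu")
    case False
    then obtain c where "lam c \<noteq> mu c" by auto
    then have "c \<in> {1..N}" using shape_outside[OF lam, of c] shape_outside[OF mu, of c] by metis
    then have "(\<Prod>c\<in>{1..N}. if lam c = mu c then 1 else (0 :: 'a mfps)) = 0"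
      using \<open>lam c \<noteq> mu c\<close> by (intro prod_zero) auto
    with False show ?thesis by simp
  qed simp
  finally show ?thesis .
qed

text \<open>
  The determinant obeys the branching rule of the tableaux.  Subtract from column \<open>c\<close> the multiple
  \<open>x\<^sub>K\<^sup>d\<close> of column \<open>Suc c\<close>, with \<open>d\<close> the difference of the two degrees; by \<open>hvars_diff\<close> column \<open>c\<close>
  becomes a combination of columns in fewer variables, one for each value \<open>q\<close> from
  \<open>lam (Suc c)\<close> to \<open>lam c\<close>.  Multilinearity then sums over the choices of all \<open>q\<close>, that is, over
  the horizontal strips.
\<close>

lemma jacobi_trudi_Suc:
  assumes lam: "shape N lam"
  shows "ldet {1..N} (\<lambda>r c. hvars (Suc K) (int (lam c) - int c - int (mu r) + int r)) =
    (\<Sum>nu\<in>strips N lam. (\<Prod>c\<in>{1..N}. mvar K ^ (lam c - nu c)) *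
       ldet {1..N} (\<lambda>r c. hvars K (int (nu c) - int c - int (mu r) + int r)))"
proof -
  let ?A = "\<lambda>r c. hvars (Suc K) (int (lam c) - int c - int (mu r) + int r) :: 'a mfps"
  let ?d = "\<lambda>c. lam c - lam (Suc c) + 1"
  have "ldet {1..N} ?A = ldet {1..N} (\<lambda>r c. ?A r c - mvar K ^ ?d c * ?A r (Suc c))"
    by (rule ldet_subtract_next_column[symmetric], rule hvars_neg) (use lam in \<open>auto simp: shape_def\<close>)
  also have "\<dots> = ldet {1..N} (\<lambda>r c. \<Sum>q\<in>{lam (Suc c)..lam c}.
      mvar K ^ (lam c - q) * hvars K (int q - int c - int (mu r) + int r))"
  proof (rule ldet_cong)
    fix r c assume "r \<in> {1..N}" "c \<in> {1..N}"
    then have le: "lam (Suc c) \<le> lam c" using lam by (auto simp: shape_def)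
    let ?k = "int (lam c) - int c - int (mu r) + int r"
    have "?A r c - mvar K ^ ?d c * ?A r (Suc c) =
        hvars (Suc K) ?k - mvar K ^ ?d c * hvars (Suc K) (?k - int (?d c))"
      using le by (simp add: of_nat_diff algebra_simps)
    also have "\<dots> = (\<Sum>j<?d c. mvar K ^ j * hvars K (?k - int j))" by (rule hvars_diff)
    also have "\<dots> = (\<Sum>q\<in>{lam (Suc c)..lam c}.
        mvar K ^ (lam c - q) * hvars K (int q - int c - int (mu r) + int r))"
      by (rule sum.reindex_bij_witness[where i = "\<lambda>q. lam c - q" and j = "\<lambda>j. lam c - j"])
        (use le in \<open>auto simp: of_nat_diff algebra_simps\<close>)
    finally show "?A r c - mvar K ^ ?d c * ?A r (Suc c) = (\<Sum>q\<in>{lam (Suc c)..lam c}.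
        mvar K ^ (lam c - q) * hvars K (int q - int c - int (mu r) + int r))" .
  qed
  also have "\<dots> = (\<Sum>f\<in>PiE {1..N} (\<lambda>c. {lam (Suc c)..lam c}). (\<Prod>c\<in>{1..N}. mvar K ^ (lam c - f c)) *
      ldet {1..N} (\<lambda>r c. hvars K (int (f c) - int c - int (mu r) + int r)))"
    by (rule ldet_sum_columns) auto
  also have "\<dots> = (\<Sum>nu\<in>strips N lam. (\<Prod>c\<in>{1..N}. mvar K ^ (lam c - nu c)) *
       ldet {1..N} (\<lambda>r c. hvars K (int (nu c) - int c - int (mu r) + int r)))"
    by (subst sum.reindex_bij_betw[OF strips_PiE[OF lam], symmetric])
      (intro sum.cong refl arg_cong2[of _ _ _ _ "(*)"] prod.cong ldet_cong, auto)
  finally show ?thesis .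
qed

lemma jacobi_trudi_vars:
  assumes "shape N lam" and mu: "shape N mu"
  shows "ldet {1..N} (\<lambda>r c. hvars K (int (lam c) - int c - int (mu r) + int r)) =
    (schur_vars K lam mu :: 'a::comm_ring_1 mfps)"
  using assms(1)
proof (induction K arbitrary: lam)
  case 0
  then show ?case by (simp only: jacobi_trudi_0[OF 0 mu] schur_vars_0[OF 0])
next
  case (Suc K)
  have dec: "\<forall>i\<ge>1. mu (Suc i) \<le> mu i" using mu by (simp add: shape_def)
  show ?case
    unfolding jacobi_trudi_Suc[OF Suc.prems] schur_vars_Suc[OF Suc.prems dec]
    by (intro sum.cong refl) (simp only: Suc.IH[OF strips_shape[OF Suc.prems]])
qed

lemma mcoeff_prod_mvar:
  assumes "finite C"
  shows "mcoeff (\<Prod>c\<in>C. mvar (T c) :: 'a::comm_ring_1 mfps) m =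
    (if \<forall>k. card {c \<in> C. T c = k} = Poly_Mapping.lookup m k then 1 else 0)"
  using assms
proof (induction C arbitrary: m)
  case empty
  then show ?case by (auto simp: one_mfps.rep_eq poly_mapping_eq_iff fun_eq_iff)
next
  case (insert c C)
  have card: "card {x \<in> insert c C. T x = k} = (if T c = k then 1 else 0) + card {x \<in> C. T x = k}" for k
  proof -
    have "{x \<in> insert c C. T x = k} = (if T c = k then {c} else {}) \<union> {x \<in> C. T x = k}" by auto
    then show ?thesis using insert(1,2) by simp
  qed
  have "mcoeff (\<Prod>x\<in>insert c C. mvar (T x) :: 'a mfps) m =
      (if Poly_Mapping.lookup m (T c) > 0 then
        mcoeff (\<Prod>x\<in>C. mvar (T x) :: 'a mfps) (m - Poly_Mapping.single (T c) 1) else 0)"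
    using insert(1,2) by (simp add: mcoeff_mvar_mult)
  also have "\<dots> = (if \<forall>k. card {x \<in> insert c C. T x = k} = Poly_Mapping.lookup m k then 1 else 0)"
  proof (cases "Poly_Mapping.lookup m (T c) > 0")
    case True
    have "(card {x \<in> C. T x = k} = Poly_Mapping.lookup (m - Poly_Mapping.single (T c) 1) k) \<longleftrightarrow>
        (card {x \<in> insert c C. T x = k} = Poly_Mapping.lookup m k)" for k
      unfolding card using True by (auto simp: lookup_minus lookup_single when_def)
    then show ?thesis unfolding insert.IH if_P[OF True] by (simp only:)
  next
    case False
    then have "card {x \<in> insert c C. T x = T c} \<noteq> Poly_Mapping.lookup m (T c)"
      using False by (subst card) simp
    then have "\<not> (\<forall>k. card {x \<in> insert c C. T x = k} = Poly_Mapping.lookup m k)" by blast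
    then show ?thesis unfolding if_not_P[OF False] by (simp only: if_False)
  qed
  finally show ?case .
qed

text \<open>
  A tableau contributing to the monomial \<open>m\<close> has only entries that occur in \<open>m\<close>, hence below \<open>K\<close>.
\<close>

lemma mcoeff_skew_schur:
  assumes K: "Poly_Mapping.keys m \<subseteq> {..<K}" and la: "shape N (part la)"
  shows "mcoeff (skew_schur la mu) m = mcoeff (schur_vars K (part la) (part mu)) m"
proof (cases "\<forall>i. part mu i \<le> part la i")
  case True
  let ?C = "cells (part la) (part mu)"
  let ?cont = "\<lambda>T. \<forall>k. card {c \<in> ?C. T c = k} = Poly_Mapping.lookup m k"
  have C: "skew_diagram la mu = ?C" by (simp add: skew_diagram_def cells_def)
  have fin: "finite ?C" by (rule finite_cells[OF la])
  have lt: "T c < K" if "?cont T" "c \<in> ?C" for T c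
  proof -
    have "c \<in> {x \<in> ?C. T x = T c}" using that by simp
    then have "card {x \<in> ?C. T x = T c} > 0"
      using fin by (subst card_gt_0_iff) (blast intro: finite_subset)
    then have "T c \<in> Poly_Mapping.keys m" using that(1) by (simp add: in_keys_iff)
    then show ?thesis using K by auto
  qed
  have "T \<in> ?C \<rightarrow>\<^sub>E UNIV \<longleftrightarrow> T \<in> ?C \<rightarrow>\<^sub>E {..<K}" if "?cont T" for T
    unfolding PiE_iff using lt[OF that] by blast
  then have "T \<in> ssyt la mu \<and> ?cont T \<longleftrightarrow> T \<in> fillings K (part la) (part mu) \<and> ?cont T" for T
    unfolding ssyt_def fillings_def C mem_Collect_eq by meson
  then have eq: "{T \<in> ssyt la mu. ?cont T} = {T \<in> fillings K (part la) (part mu). ?cont T}"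
    by (simp only:)
  have "mcoeff (schur_vars K (part la) (part mu) :: 'a mfps) m =
      (\<Sum>T\<in>fillings K (part la) (part mu). if ?cont T then 1 else 0)"
    using True by (simp add: schur_vars_def mcoeff_sum mcoeff_prod_mvar[OF fin])
  also have "\<dots> = of_nat (card {T \<in> fillings K (part la) (part mu). ?cont T})"
    by (simp add: sum.If_cases finite_fillings[OF la] Int_def)
  finally show ?thesis using True eq by (simp add: skew_schur_def C)
next
  case False
  then show ?thesis by (auto simp: skew_schur_def schur_vars_def)
qed

text \<open>
  The coefficient at a monomial involves finitely many variables only, so the identity follows from
  the one for sufficiently many variables.
\<close>

theorem jacobi_trudi:
  assumes la: "shape N (part la)" and mu: "shape N (part mu)"
  shows "ldet {1..N} (\<lambda>r c. hsym (int (part la c) - int c - int (part mu r) + int r)) =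
    (skew_schur la mu :: 'a::comm_ring_1 mfps)"
proof (rule mfps_eqI)
  fix m :: "nat \<Rightarrow>\<^sub>0 nat"
  obtain K where K: "Poly_Mapping.keys m \<subseteq> {..<K}"
    using finite_nat_set_iff_bounded[of "Poly_Mapping.keys m"] by auto
  have "mcoeff (ldet {1..N} (\<lambda>r c. hsym (int (part la c) - int c - int (part mu r) + int r) :: 'a mfps)) m =
      mcoeff (ldet {1..N} (\<lambda>r c. hvars K (int (part la c) - int c - int (part mu r) + int r))) m"
    by (intro agree_mcoeff agree_ldet agree_hsym_hvars K)
  also have "\<dots> = mcoeff (skew_schur la mu) m"
    by (simp only: jacobi_trudi_vars[OF la mu] mcoeff_skew_schur[OF K la])
  finally show "mcoeff (ldet {1..N} (\<lambda>r c. hsym (int (part la c) - int c - int (part mu r) + int r))) m =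
      mcoeff (skew_schur la mu :: 'a mfps) m" .
qed

section \<open>Expansion of a Pfaffian\<close>

text \<open>
  Columns come in consecutive pairs: the pair number \<open>i\<close>, in positions \<open>2 * i - 1\<close> and \<open>2 * i\<close>, consists
  of the two endpoints of the edge \<open>f i\<close>.
\<close>

definition pair_col :: "('t \<Rightarrow> nat) \<Rightarrow> ('t \<Rightarrow> nat) \<Rightarrow> (nat \<Rightarrow> 't) \<Rightarrow> nat \<Rightarrow> nat" where
  "pair_col lo hi f c = (if odd c then lo else hi) (f ((c + 1) div 2))"

lemma prod_pairs:
  fixes X :: "nat \<Rightarrow> 'a::comm_monoid_mult"
  shows "(\<Prod>c\<in>{1..2 * N}. X c) = (\<Prod>i = 1..N. X (2 * i - 1) * X (2 * i))"
  by (induction N) (simp_all add: mult.assoc)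

text \<open>
  Composing with the transposition of \<open>2 * i - 1\<close> and \<open>2 * i\<close> changes the sign of the permutation, so in
  a signed sum each antisymmetrized factor contributes its first term twice.  The induction treats
  the factors one at a time.
\<close>

lemma sum_antisymmetrized_pairs:
  fixes P :: "nat \<Rightarrow> nat \<Rightarrow> 'a::comm_ring_1"
  assumes "I \<subseteq> {1..N}"
  shows "(\<Sum>\<sigma> | \<sigma> permutes {1..2 * N}. of_int (sign \<sigma>) * (\<Prod>i = 1..N.
      if i \<in> I then P (\<sigma> (2 * i - 1)) (\<sigma> (2 * i)) - P (\<sigma> (2 * i)) (\<sigma> (2 * i - 1))
      else P (\<sigma> (2 * i - 1)) (\<sigma> (2 * i)))) =
    2 ^ card I * (\<Sum>\<sigma> | \<sigma> permutes {1..2 * N}.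
      of_int (sign \<sigma>) * (\<Prod>i = 1..N. P (\<sigma> (2 * i - 1)) (\<sigma> (2 * i))))"
  using finite_subset[OF assms finite_atLeastAtMost] assms
proof (induction rule: finite_subset_induct')
  case (insert j I)
  let ?F = "\<lambda>I \<sigma> i. if i \<in> I then P (\<sigma> (2 * i - 1)) (\<sigma> (2 * i)) - P (\<sigma> (2 * i)) (\<sigma> (2 * i - 1))
      else P (\<sigma> (2 * i - 1)) (\<sigma> (2 * i))"
  let ?S = "{\<sigma>. \<sigma> permutes {1..2 * N}}"
  define R where "R \<sigma> = (\<Prod>i\<in>{1..N} - {j}. ?F I \<sigma> i)" for \<sigma>
  let ?\<tau> = "transpose (2 * j - 1) (2 * j)"
  have j: "j \<in> {1..N}" "j \<notin> I" using insert by auto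
  have \<tau>: "?\<tau> permutes {1..2 * N}" using j by (intro permutes_swap_id) auto
  have "(\<Sum>\<sigma>\<in>?S. of_int (sign \<sigma>) * (P (\<sigma> (2 * j)) (\<sigma> (2 * j - 1)) * R \<sigma>)) =
      (\<Sum>\<sigma>\<in>?S. of_int (sign (\<sigma> \<circ> ?\<tau>)) * (P ((\<sigma> \<circ> ?\<tau>) (2 * j)) ((\<sigma> \<circ> ?\<tau>) (2 * j - 1)) * R (\<sigma> \<circ> ?\<tau>)))"
    by (rule sum_permutations_compose_right[OF \<tau>])
  also have "\<dots> = (\<Sum>\<sigma>\<in>?S. - (of_int (sign \<sigma>) * (P (\<sigma> (2 * j - 1)) (\<sigma> (2 * j)) * R \<sigma>)))"
  proof (rule sum.cong, simp)
    fix \<sigma> assume "\<sigma> \<in> ?S"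
    then have "sign (\<sigma> \<circ> ?\<tau>) = sign \<sigma> * sign ?\<tau>"
      by (intro sign_compose) (auto intro: permutes_imp_permutation permutation_swap_id)
    moreover have "2 * j - 1 \<noteq> 2 * j" using j by auto
    ultimately have s: "sign (\<sigma> \<circ> ?\<tau>) = - sign \<sigma>" by (simp add: sign_swap_id)
    have "?\<tau> (2 * i) = 2 * i \<and> ?\<tau> (2 * i - 1) = 2 * i - 1" if "i \<in> {1..N} - {j}" for i
    proof -
      have "i \<noteq> j" "1 \<le> i" "1 \<le> j" using that j by auto
      then have "2 * i \<noteq> 2 * j" "2 * i \<noteq> 2 * j - 1" "2 * i - 1 \<noteq> 2 * j" "2 * i - 1 \<noteq> 2 * j - 1"
        by presburger+
      then show ?thesis by (simp add: transpose_def)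
    qed
    then have "R (\<sigma> \<circ> ?\<tau>) = R \<sigma>"
      unfolding R_def by (intro prod.cong refl) (simp only: o_apply)
    then show "of_int (sign (\<sigma> \<circ> ?\<tau>)) * (P ((\<sigma> \<circ> ?\<tau>) (2 * j)) ((\<sigma> \<circ> ?\<tau>) (2 * j - 1)) * R (\<sigma> \<circ> ?\<tau>)) =
        - (of_int (sign \<sigma>) * (P (\<sigma> (2 * j - 1)) (\<sigma> (2 * j)) * R \<sigma>))"
      unfolding s by simp
  qed
  finally have flip: "(\<Sum>\<sigma>\<in>?S. of_int (sign \<sigma>) * (P (\<sigma> (2 * j)) (\<sigma> (2 * j - 1)) * R \<sigma>)) =
      - (\<Sum>\<sigma>\<in>?S. of_int (sign \<sigma>) * (P (\<sigma> (2 * j - 1)) (\<sigma> (2 * j)) * R \<sigma>))"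
    by (simp add: sum_negf)
  have R': "(\<Prod>i\<in>{1..N} - {j}. ?F (insert j I) \<sigma> i) = R \<sigma>" for \<sigma>
    unfolding R_def by (rule prod.cong) auto
  have "(\<Sum>\<sigma>\<in>?S. of_int (sign \<sigma>) * (\<Prod>i = 1..N. ?F (insert j I) \<sigma> i)) =
      (\<Sum>\<sigma>\<in>?S. of_int (sign \<sigma>) *
        ((P (\<sigma> (2 * j - 1)) (\<sigma> (2 * j)) - P (\<sigma> (2 * j)) (\<sigma> (2 * j - 1))) * R \<sigma>))"
    unfolding prod.remove[OF finite_atLeastAtMost j(1)] R' by simp
  also have "\<dots> = (\<Sum>\<sigma>\<in>?S. of_int (sign \<sigma>) * (P (\<sigma> (2 * j - 1)) (\<sigma> (2 * j)) * R \<sigma>)) -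
      (\<Sum>\<sigma>\<in>?S. of_int (sign \<sigma>) * (P (\<sigma> (2 * j)) (\<sigma> (2 * j - 1)) * R \<sigma>))"
    by (simp add: algebra_simps sum_subtractf)
  also have "\<dots> = 2 * (\<Sum>\<sigma>\<in>?S. of_int (sign \<sigma>) * (P (\<sigma> (2 * j - 1)) (\<sigma> (2 * j)) * R \<sigma>))"
    unfolding flip by simp
  also have "(\<Sum>\<sigma>\<in>?S. of_int (sign \<sigma>) * (P (\<sigma> (2 * j - 1)) (\<sigma> (2 * j)) * R \<sigma>)) =
      (\<Sum>\<sigma>\<in>?S. of_int (sign \<sigma>) * (\<Prod>i = 1..N. ?F I \<sigma> i))"
    by (subst prod.remove[OF finite_atLeastAtMost j(1)]) (simp only: R_def j(2) if_False)
  finally show ?case using insert by simp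
qed simp

text \<open>
  Exchanging two pairs of columns takes two transpositions, an even permutation.
\<close>

lemma pair_det_swap:
  assumes ab: "a \<in> {1..N}" "b \<in> {1..N}" "a \<noteq> b"
  shows "ldet {1..2 * N} (\<lambda>r c. G r (pair_col lo hi (f \<circ> transpose a b) c)) =
    ldet {1..2 * N} (\<lambda>r c. (G r (pair_col lo hi f c) :: 'a::comm_ring_1))"
proof -
  let ?\<alpha> = "transpose (2 * a - 1) (2 * b - 1)" and ?\<beta> = "transpose (2 * a) (2 * b)"
  have perm: "?\<alpha> permutes {1..2 * N}" "?\<beta> permutes {1..2 * N}"
    using ab by (auto intro!: permutes_swap_id)
  have "2 * a - 1 \<noteq> 2 * b - 1" using ab by auto
  then have s: "sign (?\<alpha> \<circ> ?\<beta>) = 1"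
    using ab by (simp add: sign_compose permutation_swap_id sign_swap_id)
  have "pair_col lo hi (f \<circ> transpose a b) c = pair_col lo hi f ((?\<alpha> \<circ> ?\<beta>) c)" if "c \<in> {1..2 * N}" for c
  proof (cases "odd c")
    case True
    then obtain i where c: "c = 2 * i - 1" "i \<ge> 1" by (elim oddE) (auto intro: that[of "_ + 1"])
    have "2 * i - 1 \<noteq> 2 * a" "2 * i - 1 \<noteq> 2 * b" using c by presburger+
    then have "(?\<alpha> \<circ> ?\<beta>) c = 2 * transpose a b i - 1"
      using c ab by (auto simp: transpose_def)
    moreover have "transpose a b i \<ge> 1" using c ab by (auto simp: transpose_def)
    ultimately show ?thesis using c by (simp add: pair_col_def)
  next
    case False
    then have "even c" by simp
    then obtain i where c: "c = 2 * i" by (elim evenE)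
    have "2 * x \<noteq> 2 * y - 1" if "y \<ge> 1" for x y :: nat using that by presburger
    then have "(?\<alpha> \<circ> ?\<beta>) c = 2 * transpose a b i"
      using c ab by (auto simp: transpose_def)
    then show ?thesis using c by (simp add: pair_col_def)
  qed
  then have "ldet {1..2 * N} (\<lambda>r c. G r (pair_col lo hi (f \<circ> transpose a b) c)) =
      ldet {1..2 * N} (\<lambda>r c. G r (pair_col lo hi f ((?\<alpha> \<circ> ?\<beta>) c)))"
    by (intro ldet_cong) simp
  also have "\<dots> = of_int (sign (?\<alpha> \<circ> ?\<beta>)) * ldet {1..2 * N} (\<lambda>r c. G r (pair_col lo hi f c))"
    by (rule ldet_permute_columns[OF permutes_compose[OF perm(2,1)]]) simp
  finally show ?thesis unfolding s by simp
qed

lemma pair_det_permute: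
  assumes "\<pi> permutes {1..N}"
  shows "ldet {1..2 * N} (\<lambda>r c. G r (pair_col lo hi (f \<circ> \<pi>) c)) =
    ldet {1..2 * N} (\<lambda>r c. (G r (pair_col lo hi f c) :: 'a::comm_ring_1))"
  using assms finite_atLeastAtMost[of 1 N]
proof (induction \<pi> arbitrary: f rule: permutes_induct)
  case (swap a b p)
  have "ldet {1..2 * N} (\<lambda>r c. G r (pair_col lo hi ((f \<circ> transpose a b) \<circ> p) c)) =
      ldet {1..2 * N} (\<lambda>r c. G r (pair_col lo hi f c))"
    by (simp only: swap.IH pair_det_swap[OF swap.hyps(1-3)])
  then show ?case by (simp only: comp_assoc)
qed simp

lemma strict_mono_on_determined_by_image:
  fixes g h :: "nat \<Rightarrow> 'b::linorder"
  assumes "strict_mono_on {1..N} g" "strict_mono_on {1..N} h" "g ` {1..N} = h ` {1..N}" "i \<in> {1..N}"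
  shows "g i = h i"
proof -
  have *: "sorted (map f [1..<Suc N]) \<and> distinct (map f [1..<Suc N])"
    if f: "strict_mono_on {1..N} f" for f :: "nat \<Rightarrow> 'b"
  proof
    show "sorted (map f [1..<Suc N])"
      unfolding sorted_iff_nth_mono_less
    proof (intro allI impI)
      fix i j assume "i < j" "j < length (map f [1..<Suc N])"
      then show "map f [1..<Suc N] ! i \<le> map f [1..<Suc N] ! j"
        using strict_mono_onD[OF f, of "Suc i" "Suc j"] by (simp del: upt_Suc)
    qed
    have "inj_on f {1..<Suc N}"
      using strict_mono_on_imp_inj_on[OF f] by (simp add: atLeastLessThanSuc_atLeastAtMost)
    then show "distinct (map f [1..<Suc N])" by (simp add: distinct_map del: upt_Suc)
  qed
  have "set (map g [1..<Suc N]) = set (map h [1..<Suc N])"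
    using assms(3) by (simp only: set_map set_upt atLeastLessThanSuc_atLeastAtMost)
  then have "map g [1..<Suc N] = map h [1..<Suc N]"
    using *[OF assms(1)] *[OF assms(2)] by (intro sorted_distinct_set_unique) blast+
  then show ?thesis using assms(4) by (simp del: upt_Suc)
qed

lemma injective_is_sorted_permuted:
  fixes f :: "nat \<Rightarrow> 'b::linorder"
  assumes inj: "inj_on f {1..N}" and f: "f \<in> {1..N} \<rightarrow>\<^sub>E T"
  shows "\<exists>g \<pi>. g \<in> {1..N} \<rightarrow>\<^sub>E T \<and> strict_mono_on {1..N} g \<and> \<pi> permutes {1..N} \<and> f = g \<circ> \<pi>"
proof -
  let ?xs = "sorted_list_of_set (f ` {1..N})"
  have len: "length ?xs = N" using inj by (simp add: card_image)
  define g where "g = (\<lambda>i. if i \<in> {1..N} then ?xs ! (i - 1) else undefined)"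
  have mono: "strict_mono_on {1..N} g"
    using strict_sorted_list_of_set[of "f ` {1..N}"] len
    by (intro strict_mono_onI) (auto simp: g_def sorted_wrt_iff_nth_less)
  have "g ` {1..N} = set ?xs"
  proof
    show "g ` {1..N} \<subseteq> set ?xs" using len
      by (auto simp: g_def simp del: set_sorted_list_of_set intro!: nth_mem)
    show "set ?xs \<subseteq> g ` {1..N}"
    proof
      fix x assume "x \<in> set ?xs"
      then obtain k where "k < N" "x = ?xs ! k" using len by (metis in_set_conv_nth)
      then show "x \<in> g ` {1..N}" by (intro image_eqI[of _ _ "Suc k"]) (auto simp: g_def)
    qed
  qed
  then have img: "g ` {1..N} = f ` {1..N}" by simp
  have bij: "bij_betw g {1..N} (f ` {1..N})"
    using strict_mono_on_imp_inj_on[OF mono] img by (simp add: bij_betw_def)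
  define \<pi> where "\<pi> = (\<lambda>i. if i \<in> {1..N} then inv_into {1..N} g (f i) else i)"
  have "bij_betw (inv_into {1..N} g \<circ> f) {1..N} {1..N}"
    by (rule bij_betw_trans[OF _ bij_betw_inv_into[OF bij]]) (use inj in \<open>simp add: bij_betw_def\<close>)
  then have "bij_betw \<pi> {1..N} {1..N}"
    by (rule bij_betw_cong[THEN iffD1, rotated]) (simp add: \<pi>_def)
  then have \<pi>: "\<pi> permutes {1..N}" by (rule bij_imp_permutes) (auto simp: \<pi>_def)
  have "f i = (g \<circ> \<pi>) i" for i
  proof (cases "i \<in> {1..N}")
    case True
    then show ?thesis using bij_betw_inv_into_right[OF bij, of "f i"] by (simp add: \<pi>_def)
  next
    case False
    then have "g i = undefined" "\<pi> i = i" unfolding g_def \<pi>_def by (rule if_not_P)+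
    then show ?thesis using PiE_arb[OF f False] by simp
  qed
  moreover have "g \<in> {1..N} \<rightarrow>\<^sub>E T"
  proof
    fix i assume "i \<in> {1..N}"
    then have "g i \<in> f ` {1..N}" using img by blast
    then show "g i \<in> T" using f by auto
  next
    fix i assume "i \<notin> {1..N}"
    then show "g i = undefined" unfolding g_def by (rule if_not_P)
  qed
  ultimately show ?thesis using mono \<pi> by blast
qed

text \<open>
  An injective function from \<open>{1..N}\<close> into a linear order is uniquely an increasing function composed
  with a permutation.
\<close>

lemma sum_injective_symmetric:
  fixes T :: "'b::linorder set" and \<Phi> :: "(nat \<Rightarrow> 'b) \<Rightarrow> 'a::comm_ring_1"
  assumes sym: "\<And>f \<pi>. \<pi> permutes {1..N} \<Longrightarrow> \<Phi> (f \<circ> \<pi>) = \<Phi> f"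
  shows "(\<Sum>f | f \<in> {1..N} \<rightarrow>\<^sub>E T \<and> inj_on f {1..N}. \<Phi> f) =
    of_nat (fact N) * (\<Sum>g | g \<in> {1..N} \<rightarrow>\<^sub>E T \<and> strict_mono_on {1..N} g. \<Phi> g)"
proof -
  let ?G = "{g. g \<in> {1..N} \<rightarrow>\<^sub>E T \<and> strict_mono_on {1..N} g}" and ?S = "{\<pi>. \<pi> permutes {1..N}}"
  let ?F = "{f. f \<in> {1..N} \<rightarrow>\<^sub>E T \<and> inj_on f {1..N}}"
  have "bij_betw (\<lambda>(g, \<pi>). g \<circ> \<pi>) (?G \<times> ?S) ?F"
    unfolding bij_betw_def
  proof
    show "inj_on (\<lambda>(g, \<pi>). g \<circ> \<pi>) (?G \<times> ?S)"
    proof (rule inj_onI, clarify)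
      fix g h \<pi> \<rho>
      assume g: "g \<in> {1..N} \<rightarrow>\<^sub>E T" "strict_mono_on {1..N} g" and h: "h \<in> {1..N} \<rightarrow>\<^sub>E T" "strict_mono_on {1..N} h"
        and \<pi>: "\<pi> permutes {1..N}" and \<rho>: "\<rho> permutes {1..N}" and eq: "g \<circ> \<pi> = h \<circ> \<rho>"
      have "g ` {1..N} = (g \<circ> \<pi>) ` {1..N}" by (simp only: image_comp[symmetric] permutes_image[OF \<pi>])
      also have "\<dots> = h ` {1..N}" by (simp only: eq image_comp[symmetric] permutes_image[OF \<rho>])
      finally have img: "g ` {1..N} = h ` {1..N}" .
      have "g = h"
        by (rule PiE_ext[OF g(1) h(1)]) (rule strict_mono_on_determined_by_image[OF g(2) h(2) img])
      moreover have "\<pi> i = \<rho> i" for i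
      proof (cases "i \<in> {1..N}")
        case True
        then have "\<pi> i \<in> {1..N}" "\<rho> i \<in> {1..N}"
          using permutes_in_image[OF \<pi>, of i] permutes_in_image[OF \<rho>, of i] by blast+
        moreover have "g (\<pi> i) = g (\<rho> i)" using fun_cong[OF eq, of i] \<open>g = h\<close> by simp
        ultimately show ?thesis using inj_onD[OF strict_mono_on_imp_inj_on[OF g(2)]] by blast
      next
        case False
        then show ?thesis using permutes_not_in[OF \<pi>] permutes_not_in[OF \<rho>] by metis
      qed
      ultimately show "g = h \<and> \<pi> = \<rho>" by blast
    qed
    show "(\<lambda>(g, \<pi>). g \<circ> \<pi>) ` (?G \<times> ?S) = ?F"
    proof
      show "(\<lambda>(g, \<pi>). g \<circ> \<pi>) ` (?G \<times> ?S) \<subseteq> ?F"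
      proof clarify
        fix g \<pi> assume g: "g \<in> {1..N} \<rightarrow>\<^sub>E T" "strict_mono_on {1..N} g" and \<pi>: "\<pi> permutes {1..N}"
        have "g \<circ> \<pi> \<in> {1..N} \<rightarrow>\<^sub>E T"
        proof
          fix i assume "i \<in> {1..N}"
          then have "\<pi> i \<in> {1..N}" using permutes_in_image[OF \<pi>] by blast
          then show "(g \<circ> \<pi>) i \<in> T" using g(1) by auto
        next
          fix i assume "i \<notin> {1..N}"
          then show "(g \<circ> \<pi>) i = undefined" using permutes_not_in[OF \<pi>] PiE_arb[OF g(1)] by (metis o_apply)
        qed
        moreover have "inj_on (g \<circ> \<pi>) {1..N}"
          using permutes_inj_on[OF \<pi>] strict_mono_on_imp_inj_on[OF g(2)] permutes_image[OF \<pi>]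
          by (intro comp_inj_on) simp_all
        ultimately show "g \<circ> \<pi> \<in> {1..N} \<rightarrow>\<^sub>E T \<and> inj_on (g \<circ> \<pi>) {1..N}" by blast
      qed
      show "?F \<subseteq> (\<lambda>(g, \<pi>). g \<circ> \<pi>) ` (?G \<times> ?S)"
      proof
        fix f assume "f \<in> ?F"
        then obtain g \<pi> where "g \<in> ?G" "\<pi> \<in> ?S" "f = g \<circ> \<pi>"
          using injective_is_sorted_permuted[of f N T] by blast
        then show "f \<in> (\<lambda>(g, \<pi>). g \<circ> \<pi>) ` (?G \<times> ?S)" by (intro image_eqI[of _ _ "(g, \<pi>)"]) auto
      qed
    qed
  qed
  then have "(\<Sum>f\<in>?F. \<Phi> f) = (\<Sum>(g, \<pi>)\<in>?G \<times> ?S. \<Phi> (g \<circ> \<pi>))"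
    by (subst sum.reindex_bij_betw[symmetric]) (auto intro: sum.cong)
  also have "\<dots> = (\<Sum>(g, \<pi>)\<in>?G \<times> ?S. \<Phi> g)" by (rule sum.cong) (auto simp: sym)
  also have "\<dots> = (\<Sum>g\<in>?G. of_nat (fact N) * \<Phi> g)"
    by (simp add: sum.cartesian_product[symmetric] card_permutations)
  finally show ?thesis by (simp add: sum_distrib_left)
qed

lemma rat_const_add: "rat_const (c + d) = rat_const c + rat_const d"
  unfolding rat_const_def
  by (rule mfps_eqI) (simp add: mconst.rep_eq plus_mfps.rep_eq single_add)

lemma of_nat_mult_rat_const: "of_nat k * rat_const c = rat_const (of_nat k * c)"
proof (induction k)
  case 0
  then show ?case by (simp add: rat_const_def mfps_eqI mconst.rep_eq zero_mfps.rep_eq)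
next
  case (Suc k)
  then show ?case by (simp add: algebra_simps rat_const_add)
qed

lemma rat_const_1: "rat_const 1 = 1"
  unfolding rat_const_def by (rule mfps_eqI) (simp add: mconst.rep_eq one_mfps.rep_eq)

lemma rat_const_inverse_mult: "k > 0 \<Longrightarrow> rat_const (1 / of_nat k) * (of_nat k * X) = X"
  using of_nat_mult_rat_const[of k "1 / of_nat k"]
  by (simp add: rat_const_1 mult.assoc[symmetric] mult.commute[of "rat_const _"])

text \<open>
  A Pfaffian analogue of the Cauchy-Binet formula, for a skew-symmetric matrix given by weighted edges
  \<open>t\<close> from \<open>lo t\<close> to \<open>hi t\<close>.  The powers of 2 in the definition of the Pfaffian account for the two
  orientations of the edges and the factorial for their order; a repeated edge gives a minor with
  equal columns.
\<close>

theorem Pf_minor_sum: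
  fixes T :: "'b::linorder set" and G :: "nat \<Rightarrow> nat \<Rightarrow> vpoly mfps"
  assumes T: "finite T"
  shows "Pf N (\<lambda>a b. \<Sum>t\<in>T. w t * (G a (lo t) * G b (hi t) - G a (hi t) * G b (lo t))) =
    (\<Sum>g | g \<in> {1..N} \<rightarrow>\<^sub>E T \<and> strict_mono_on {1..N} g.
       (\<Prod>i = 1..N. w (g i)) * ldet {1..2 * N} (\<lambda>r c. G r (pair_col lo hi g c)))"
proof -
  define P where "P a b = (\<Sum>t\<in>T. w t * (G a (lo t) * G b (hi t)))" for a b
  define \<Phi> where "\<Phi> f = (\<Prod>i = 1..N. w (f i)) * ldet {1..2 * N} (\<lambda>r c. G r (pair_col lo hi f c))" for f
  let ?S = "{\<sigma>. \<sigma> permutes {1..2 * N}}" and ?E = "{1..N} \<rightarrow>\<^sub>E T"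
  have M: "(\<Sum>t\<in>T. w t * (G a (lo t) * G b (hi t) - G a (hi t) * G b (lo t))) = P a b - P b a" for a b
    by (simp add: P_def sum_subtractf algebra_simps)
  have "(\<Sum>\<sigma>\<in>?S. of_int (sign \<sigma>) *
        (\<Prod>i = 1..N. P (\<sigma> (2 * i - 1)) (\<sigma> (2 * i)) - P (\<sigma> (2 * i)) (\<sigma> (2 * i - 1)))) =
      2 ^ N * (\<Sum>\<sigma>\<in>?S. of_int (sign \<sigma>) * (\<Prod>i = 1..N. P (\<sigma> (2 * i - 1)) (\<sigma> (2 * i))))"
  proof -
    have "(\<Prod>i = 1..N. if i \<in> {1..N} then P (\<sigma> (2 * i - 1)) (\<sigma> (2 * i)) - P (\<sigma> (2 * i)) (\<sigma> (2 * i - 1))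
        else P (\<sigma> (2 * i - 1)) (\<sigma> (2 * i))) =
      (\<Prod>i = 1..N. P (\<sigma> (2 * i - 1)) (\<sigma> (2 * i)) - P (\<sigma> (2 * i)) (\<sigma> (2 * i - 1)))" for \<sigma>
      by (rule prod.cong) auto
    then show ?thesis using sum_antisymmetrized_pairs[of "{1..N}" N P] by simp
  qed
  also have "(\<Sum>\<sigma>\<in>?S. of_int (sign \<sigma>) * (\<Prod>i = 1..N. P (\<sigma> (2 * i - 1)) (\<sigma> (2 * i)))) =
      (\<Sum>\<sigma>\<in>?S. \<Sum>f\<in>?E. of_int (sign \<sigma>) *
        (\<Prod>i = 1..N. w (f i) * (G (\<sigma> (2 * i - 1)) (lo (f i)) * G (\<sigma> (2 * i)) (hi (f i)))))"
    unfolding P_def by (simp add: prod_sum_PiE T sum_distrib_left)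
  also have "\<dots> = (\<Sum>f\<in>?E. \<Sum>\<sigma>\<in>?S. of_int (sign \<sigma>) *
        (\<Prod>i = 1..N. w (f i) * (G (\<sigma> (2 * i - 1)) (lo (f i)) * G (\<sigma> (2 * i)) (hi (f i)))))"
    by (rule sum.swap)
  also have "\<dots> = (\<Sum>f\<in>?E. \<Phi> f)"
  proof (rule sum.cong[OF refl])
    fix f
    have "(\<Prod>c\<in>{1..2 * N}. G (\<sigma> c) (pair_col lo hi f c)) =
        (\<Prod>i = 1..N. G (\<sigma> (2 * i - 1)) (lo (f i)) * G (\<sigma> (2 * i)) (hi (f i)))" for \<sigma>
      unfolding prod_pairs by (rule prod.cong) (auto simp: pair_col_def)
    then show "(\<Sum>\<sigma>\<in>?S. of_int (sign \<sigma>) *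
        (\<Prod>i = 1..N. w (f i) * (G (\<sigma> (2 * i - 1)) (lo (f i)) * G (\<sigma> (2 * i)) (hi (f i))))) = \<Phi> f"
      by (simp add: \<Phi>_def ldet_def prod.distrib sum_distrib_left mult.left_commute)
  qed
  also have "\<dots> = (\<Sum>f | f \<in> ?E \<and> inj_on f {1..N}. \<Phi> f)"
  proof (rule sum.mono_neutral_right)
    show "finite ?E" by (simp add: finite_PiE T)
    show "\<forall>f\<in>?E - {f. f \<in> ?E \<and> inj_on f {1..N}}. \<Phi> f = 0"
    proof
      fix f assume "f \<in> ?E - {f. f \<in> ?E \<and> inj_on f {1..N}}"
      then obtain i j where "i \<in> {1..N}" "j \<in> {1..N}" "i \<noteq> j" "f i = f j" by (auto simp: inj_on_def)
      then have "ldet {1..2 * N} (\<lambda>r c. G r (pair_col lo hi f c)) = 0"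
        by (intro ldet_equal_columns[of _ "2 * i" "2 * j"]) (auto simp: pair_col_def)
      then show "\<Phi> f = 0" by (simp add: \<Phi>_def)
    qed
  qed auto
  also have "\<dots> = of_nat (fact N) * (\<Sum>g | g \<in> ?E \<and> strict_mono_on {1..N} g. \<Phi> g)"
  proof (rule sum_injective_symmetric)
    fix f \<pi> assume \<pi>: "\<pi> permutes {1..N}"
    have "(\<Prod>i = 1..N. w ((f \<circ> \<pi>) i)) = (\<Prod>i = 1..N. w (f i))"
      using prod.permute[OF \<pi>, of "\<lambda>i. w (f i)"] by (simp add: o_def)
    then show "\<Phi> (f \<circ> \<pi>) = \<Phi> f" unfolding \<Phi>_def pair_det_permute[OF \<pi>] by simp
  qed
  finally have "Pf N (\<lambda>a b. P a b - P b a) = rat_const (1 / of_nat (2 ^ N * fact N)) *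
      (of_nat (2 ^ N * fact N) * (\<Sum>g | g \<in> ?E \<and> strict_mono_on {1..N} g. \<Phi> g))"
    unfolding Pf_def by (simp add: mult.assoc)
  also have "\<dots> = (\<Sum>g | g \<in> ?E \<and> strict_mono_on {1..N} g. \<Phi> g)"
    by (rule rat_const_inverse_mult) simp
  finally show ?thesis unfolding M \<Phi>_def .
qed

section \<open>The edges of the bordered matrix\<close>

text \<open>
  The entries of \<open>Omega_tilde p\<close> above the diagonal form the edges of a graph on the columns: an
  edge of weight 1 from 1 to \<open>p\<close>, and the edges from \<open>t\<close> to \<open>t + 1\<close> of weight \<open>v\<^bsub>t-1\<^esub>\<close> for \<open>t > p\<close>.
  The border shifts all indices by one, so no edge starts at \<open>p\<close> and the number \<open>p\<close> is free to name
  the exceptional first edge; this makes it the smallest edge as well.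
\<close>

definition edge_lo :: "nat \<Rightarrow> nat \<Rightarrow> nat" where
  "edge_lo p t = (if t = p then 1 else t)"

definition edge_hi :: "nat \<Rightarrow> nat \<Rightarrow> nat" where
  "edge_hi p t = (if t = p then p else t + 1)"

definition edge_wt :: "nat \<Rightarrow> nat \<Rightarrow> vpoly mfps" where
  "edge_wt p t = (if t = p then 1 else vvar (t - 1))"

lemma Omega_tilde_edges:
  assumes p: "2 \<le> p" "p < B" and k: "k \<in> {1..B}" and l: "l \<in> {1..B}"
  shows "Omega_tilde p k l = (\<Sum>t\<in>{p..<B}. edge_wt p t *
    ((if k = edge_lo p t \<and> l = edge_hi p t then 1 else 0) -
     (if k = edge_hi p t \<and> l = edge_lo p t then 1 else 0)))"
proof -
  define f where "f t = edge_wt p t *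
    ((if k = edge_lo p t \<and> l = edge_hi p t then 1 else 0) -
     (if k = edge_hi p t \<and> l = edge_lo p t then 1 else 0))" for t
  \<comment> \<open>The only edge that can join \<open>k\<close> and \<open>l\<close>, if any does.\<close>
  define t0 where "t0 = (if min k l = 1 then p else min k l)"
  have "f t = (if t = t0 then f t0 else 0)" if "t \<in> {p..<B}" for t
  proof (cases "t = t0")
    case False
    have lt: "edge_lo p t < edge_hi p t" using p by (simp add: edge_lo_def edge_hi_def)
    have "t = (if edge_lo p t = 1 then p else edge_lo p t)" using that p by (simp add: edge_lo_def)
    then have "min k l \<noteq> edge_lo p t" using False unfolding t0_def by metis
    moreover have "min (edge_lo p t) (edge_hi p t) = edge_lo p t" "min (edge_hi p t) (edge_lo p t) = edge_lo p t"
      using lt by simp_all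
    ultimately have "\<not> (k = edge_lo p t \<and> l = edge_hi p t)" "\<not> (k = edge_hi p t \<and> l = edge_lo p t)"
      by blast+
    then have "f t = 0" unfolding f_def by (simp only: if_False diff_self mult_zero_right)
    with False show ?thesis by simp
  qed simp
  then have "(\<Sum>t\<in>{p..<B}. f t) = (\<Sum>t\<in>{p..<B}. if t = t0 then f t0 else 0)" by (rule sum.cong[OF refl])
  also have "\<dots> = (if t0 \<in> {p..<B} then f t0 else 0)" by simp
  also have "\<dots> = Omega_tilde p k l"
  proof (cases "k = 1 \<or> l = 1")
    case True
    then have t0: "t0 = p" using k l by (auto simp: t0_def)
    show ?thesis unfolding t0 using True p k l
      by (auto simp: f_def edge_lo_def edge_hi_def edge_wt_def Omega_tilde_def bordered_def wvec_def)
  next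
    case False
    then have t0: "t0 = min k l" using k l by (auto simp: t0_def min_def)
    obtain i j where ij: "k = Suc i" "l = Suc j" "i \<ge> 1" "j \<ge> 1"
      using False k l by (auto intro: that[of "k - 1" "l - 1"])
    have W: "Omega_tilde p k l = Omega p i j" using ij by (simp add: Omega_tilde_def bordered_def)
    show ?thesis
    proof (cases i j rule: linorder_cases)
      case less
      then have "t0 = Suc i" using t0 ij by simp
      then show ?thesis unfolding W using less ij p l
        by (simp add: f_def edge_lo_def edge_hi_def edge_wt_def Omega_def)
    next
      case equal
      then show ?thesis unfolding W by (simp add: f_def Omega_def ij)
    next
      case greater
      then have "t0 = Suc j" using t0 ij by simp
      then show ?thesis unfolding W using greater ij p k
        by (simp add: f_def edge_lo_def edge_hi_def edge_wt_def Omega_def)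
    qed
  qed
  finally show ?thesis by (simp only: f_def)
qed

lemma sum_Omega_tilde:
  assumes p: "2 \<le> p" "p < B"
  shows "(\<Sum>l\<in>{1..B}. (\<Sum>k\<in>{1..B}. x k * Omega_tilde p k l) * y l) =
    (\<Sum>t\<in>{p..<B}. edge_wt p t * (x (edge_lo p t) * y (edge_hi p t) - x (edge_hi p t) * y (edge_lo p t)))"
proof -
  let ?L = "edge_lo p" and ?H = "edge_hi p" and ?w = "edge_wt p"
  let ?d = "\<lambda>P. if P then 1 else (0 :: vpoly mfps)"
  have delta: "(\<Sum>l\<in>{1..B}. \<Sum>k\<in>{1..B}. ?d (k = u \<and> l = v) * (x k * y l)) = x u * y v"
    if "u \<in> {1..B}" "v \<in> {1..B}" for u v
  proof -
    have "(\<Sum>k\<in>{1..B}. ?d (k = u \<and> l = v) * (x k * y l)) = (if l = v then x u * y l else 0)" for l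
    proof -
      have "(\<Sum>k\<in>{1..B}. ?d (k = u \<and> l = v) * (x k * y l)) =
          (\<Sum>k\<in>{1..B}. if k = u then (if l = v then x u * y l else 0) else 0)"
        by (rule sum.cong) auto
      then show ?thesis using that by simp
    qed
    then show ?thesis using that by simp
  qed
  have "(\<Sum>l\<in>{1..B}. (\<Sum>k\<in>{1..B}. x k * Omega_tilde p k l) * y l) =
      (\<Sum>l\<in>{1..B}. \<Sum>k\<in>{1..B}. \<Sum>t\<in>{p..<B}. ?w t *
        (?d (k = ?L t \<and> l = ?H t) * (x k * y l) - ?d (k = ?H t \<and> l = ?L t) * (x k * y l)))"
    unfolding sum_distrib_right
  proof (intro sum.cong refl)
    fix l k assume kl: "l \<in> {1..B}" "k \<in> {1..B}"
    have "x k * Omega_tilde p k l * y l = Omega_tilde p k l * (x k * y l)" by (simp add: ac_simps)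
    also have "\<dots> = (\<Sum>t\<in>{p..<B}. ?w t * (?d (k = ?L t \<and> l = ?H t) - ?d (k = ?H t \<and> l = ?L t)) * (x k * y l))"
      unfolding Omega_tilde_edges[OF p kl(2,1)] sum_distrib_right ..
    also have "\<dots> = (\<Sum>t\<in>{p..<B}. ?w t *
        (?d (k = ?L t \<and> l = ?H t) * (x k * y l) - ?d (k = ?H t \<and> l = ?L t) * (x k * y l)))"
      by (simp only: mult.assoc left_diff_distrib)
    finally show "x k * Omega_tilde p k l * y l = \<dots>" .
  qed
  also have "\<dots> = (\<Sum>t\<in>{p..<B}. \<Sum>l\<in>{1..B}. \<Sum>k\<in>{1..B}. ?w t *
        (?d (k = ?L t \<and> l = ?H t) * (x k * y l) - ?d (k = ?H t \<and> l = ?L t) * (x k * y l)))"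
    by (subst sum.swap, subst (2) sum.swap) (rule refl)
  also have "\<dots> = (\<Sum>t\<in>{p..<B}. ?w t * (x (?L t) * y (?H t) - x (?H t) * y (?L t)))"
  proof (rule sum.cong[OF refl])
    fix t assume "t \<in> {p..<B}"
    then have t: "?L t \<in> {1..B}" "?H t \<in> {1..B}" using p by (auto simp: edge_lo_def edge_hi_def)
    show "(\<Sum>l\<in>{1..B}. \<Sum>k\<in>{1..B}. ?w t *
        (?d (k = ?L t \<and> l = ?H t) * (x k * y l) - ?d (k = ?H t \<and> l = ?L t) * (x k * y l))) =
        ?w t * (x (?L t) * y (?H t) - x (?H t) * y (?L t))"
      unfolding sum_distrib_left[symmetric] sum_subtractf delta[OF t] delta[OF t(2,1)] ..
  qed
  finally show ?thesis .
qed

text \<open>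
  At a fixed monomial the two infinite matrix products are finite sums, hence a sum over finitely many
  edges as in \<open>Pf_minor_sum\<close>.
\<close>

lemma agree_product_entry:
  assumes p: "2 \<le> p" "p < B"
    and van: "\<And>l. l > B \<Longrightarrow> agree m (H a l) 0" "\<And>l. l > B \<Longrightarrow> agree m (H b l) 0"
  shows "agree m (imat_mult (imat_mult H (Omega_tilde p)) (imat_transpose H) a b)
    (\<Sum>t\<in>{p..<B}. edge_wt p t *
      (H a (edge_lo p t) * H b (edge_hi p t) - H a (edge_hi p t) * H b (edge_lo p t)))"
proof -
  have inner: "agree m (imat_mult H (Omega_tilde p) a l) (\<Sum>k\<in>{1..B}. H a k * Omega_tilde p k l)" for l
    unfolding imat_mult_def
  proof (rule agree_msum)
    fix k assume "k \<in> {1..} - {1..B}"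
    then have "agree m (H a k * Omega_tilde p k l) (0 * Omega_tilde p k l)"
      by (intro agree_mult van agree_refl) auto
    then show "agree m (H a k * Omega_tilde p k l) 0" by simp
  qed auto
  have "agree m (imat_mult (imat_mult H (Omega_tilde p)) (imat_transpose H) a b)
      (\<Sum>l\<in>{1..B}. imat_mult H (Omega_tilde p) a l * H b l)"
    unfolding imat_mult_def[of "imat_mult H (Omega_tilde p)"] imat_transpose_def
  proof (rule agree_msum)
    fix l assume "l \<in> {1..} - {1..B}"
    then have "agree m (imat_mult H (Omega_tilde p) a l * H b l) (imat_mult H (Omega_tilde p) a l * 0)"
      by (intro agree_mult van agree_refl) auto
    then show "agree m (imat_mult H (Omega_tilde p) a l * H b l) 0" by simp
  qed auto
  moreover have "agree m (\<Sum>l\<in>{1..B}. imat_mult H (Omega_tilde p) a l * H b l)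
      (\<Sum>l\<in>{1..B}. (\<Sum>k\<in>{1..B}. H a k * Omega_tilde p k l) * H b l)"
    by (intro agree_sum agree_mult agree_refl inner)
  ultimately show ?thesis unfolding sum_Omega_tilde[OF p, of "H a" "H b"] by (rule agree_trans)
qed

lemma agree_Pf:
  assumes "\<And>a b. a \<in> {1..2 * N} \<Longrightarrow> b \<in> {1..2 * N} \<Longrightarrow> agree m (M a b) (M' a b)"
  shows "agree m (Pf N M) (Pf N M')"
  unfolding Pf_def
proof (intro agree_mult agree_sum agree_prod agree_refl assms)
  fix \<sigma> i assume "\<sigma> \<in> {\<sigma>. \<sigma> permutes {1..2 * N}}" and i: "i \<in> {1..N}"
  then have \<sigma>: "\<sigma> permutes {1..2 * N}" by simp
  have "2 * i - 1 \<in> {1..2 * N}" "2 * i \<in> {1..2 * N}" using i by auto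
  then show "\<sigma> (2 * i - 1) \<in> {1..2 * N}" "\<sigma> (2 * i) \<in> {1..2 * N}"
    using permutes_in_image[OF \<sigma>] by blast+
qed

text \<open>
  Far to the right the entries have degree greater than that of the monomial.
\<close>

lemma Htilde_vanishes:
  assumes b: "b \<le> l + 1" and c: "c > mdeg m + l + 1 + sum_list mu"
  shows "agree m (Htilde l mu b c) 0"
  unfolding agree_def
proof (intro allI impI)
  fix x y assume "x + y = m"
  then have le: "mdeg x \<le> mdeg m" using mdeg_add[of x y] by simp
  have "part mu i \<le> sum_list mu" for i by (auto simp: part_def intro: member_le_sum_list)
  then have "part mu (l + 1 - (b - 1)) \<le> sum_list mu" .
  then have "int (mdeg x) \<noteq> int (c - 1) - int (b - 1) - int (part mu (l + 1 - (b - 1)))"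
    using le b c by linarith
  then show "mcoeff (Htilde l mu b c) x = mcoeff 0 x"
    using c by (auto simp: Htilde_def bordered_def Hmat_def hsym_def zero_mfps.rep_eq)
qed

section \<open>Partitions\<close>

lemma shape_part:
  assumes mu: "is_partition mu" and len: "plen mu \<le> N"
  shows "shape N (part mu)"
proof -
  have dec: "part mu j \<le> part mu i" if "1 \<le> i" "i \<le> j" for i j
  proof (cases "j \<le> length mu \<and> i < j")
    case True
    then show ?thesis
      using mu that unfolding is_partition_def sorted_wrt_iff_nth_less by (auto simp: part_def)
  next
    case False
    then show ?thesis using that by (auto simp: part_def)
  qed
  have fin: "finite {i. part mu i \<noteq> 0}"
    by (rule finite_subset[of _ "{..length mu}"]) (auto simp: part_def split: if_splits)
  have "part mu i = 0" if "i > N" for i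
  proof (rule ccontr)
    assume nz: "part mu i \<noteq> 0"
    have "{1..i} \<subseteq> {i. part mu i \<noteq> 0}"
    proof
      fix k assume "k \<in> {1..i}"
      then show "k \<in> {i. part mu i \<noteq> 0}" using dec[of k i] nz by simp
    qed
    then have "i \<le> plen mu" using card_mono[OF fin, of "{1..i}"] by (simp add: plen_def)
    with len that show False by simp
  qed
  moreover have "part mu 0 = 0" by (simp add: part_def)
  ultimately show ?thesis using dec by (simp add: shape_def)
qed

lemma nth_concat_pairs:
  "k < 2 * length xs \<Longrightarrow> concat (map (\<lambda>x. [f x, f x]) xs) ! k = f (xs ! (k div 2))"
proof (induction xs arbitrary: k)
  case (Cons x xs)
  show ?case
  proof (cases "k < 2")
    case True
    then have "k = 0 \<or> k = 1" by auto
    then show ?thesis by auto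
  next
    case False
    then obtain j where k: "k = Suc (Suc j)" by (metis add_2_eq_Suc le_add_diff_inverse not_less)
    then show ?thesis using Cons by simp
  qed
qed simp

lemma length_concat_pairs: "length (concat (map (\<lambda>x. [f x, f x]) xs)) = 2 * length xs"
  by (induction xs) auto

lemma part_doubled_shape:
  assumes "length a = n"
  shows "part (doubled_shape p a) i = (if i \<in> {1..2 * n} then a ! (n - 1 - (i - 1) div 2) + p - 2
    else if i = 2 * n + 1 then p - 2 else 0)"
proof -
  let ?xs = "concat (map (\<lambda>x. [x + p - 2, x + p - 2]) (rev a))"
  have len: "length ?xs = 2 * n" using assms by (simp only: length_concat_pairs length_rev)
  consider "i \<in> {1..2 * n}" | "i = 2 * n + 1" | "i = 0" | "i > 2 * n + 1" by fastforce
  then show ?thesis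
  proof cases
    case 1
    then have "i - 1 < 2 * n" by auto
    then have "?xs ! (i - 1) = rev a ! ((i - 1) div 2) + p - 2"
      using assms by (subst nth_concat_pairs) auto
    also have "rev a ! ((i - 1) div 2) = a ! (n - 1 - (i - 1) div 2)"
    proof -
      have "(i - 1) div 2 < n" using 1 by auto
      then show ?thesis using assms by (simp add: rev_nth)
    qed
    finally show ?thesis
      using 1 len \<open>i - 1 < 2 * n\<close> by (simp add: part_def doubled_shape_def nth_append)
  qed (use len in \<open>auto simp: part_def doubled_shape_def nth_append\<close>)
qed

lemma shape_doubled_shape:
  assumes len: "length a = n" and a: "sorted a"
  shows "shape (2 * n + 1) (part (doubled_shape p a))"
proof -
  have "part (doubled_shape p a) (Suc i) \<le> part (doubled_shape p a) i" if i: "1 \<le> i" for i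
  proof (cases "i < 2 * n")
    case True
    have "n - 1 - i div 2 \<le> n - 1 - (i - 1) div 2" by (intro diff_le_mono2 div_le_mono) simp
    then have "a ! (n - 1 - i div 2) \<le> a ! (n - 1 - (i - 1) div 2)"
      using True len by (intro sorted_nth_mono[OF a]) auto
    then show ?thesis using True i by (simp add: part_doubled_shape[OF len] diff_le_mono)
  next
    case False
    then show ?thesis using i by (auto simp: part_doubled_shape[OF len])
  qed
  then show ?thesis by (simp add: shape_def part_doubled_shape[OF len])
qed

section \<open>The nonzero terms\<close>

text \<open>
  The increasing sequence of edges \<open>g 1 < g 2 < \<dots>\<close> belonging to \<open>a = [a\<^sub>1, \<dots>, a\<^sub>n]\<close>: the exceptional
  edge, followed by the edges starting at \<open>a\<^sub>r + p + 2 * r - 1\<close>, that is, \<open>r = i - 1\<close>.  The summand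
  \<open>2 * r\<close> converts a weakly increasing sequence into one with gaps of at least 2, as disjointness of
  the edges requires.
\<close>

definition edge_seq :: "nat \<Rightarrow> nat \<Rightarrow> nat list \<Rightarrow> nat \<Rightarrow> nat" where
  "edge_seq n p a = (\<lambda>i. if i = 1 then p
     else if i \<in> {2..n + 1} then a ! (i - 2) + p + 2 * i - 3 else undefined)"

abbreviation edge_col :: "nat \<Rightarrow> (nat \<Rightarrow> nat) \<Rightarrow> nat \<Rightarrow> nat" where
  "edge_col p \<equiv> pair_col (edge_lo p) (edge_hi p)"

text \<open>
  The columns of the minor exceed their positions by the parts of the doubled shape in reverse order:
  the two endpoints of an edge are consecutive, whence the doubled parts, and the endpoint \<open>p\<close> of the
  exceptional edge in position 2 accounts for the final part \<open>p - 2\<close>.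
\<close>

lemma edge_col_edge_seq:
  assumes p: "2 \<le> p" and len: "length a = n" and c: "c \<in> {2..2 * n + 2}"
  shows "edge_col p (edge_seq n p a) c = part (doubled_shape p a) (2 * n + 3 - c) + c"
proof (cases "c = 2")
  case True
  then show ?thesis
    using p by (simp add: pair_col_def edge_seq_def edge_hi_def part_doubled_shape[OF len])
next
  case False
  define i where "i = (c + 1) div 2"
  have i: "i \<in> {2..n + 1}" and ci: "c = (if odd c then 2 * i - 1 else 2 * i)"
    using c False unfolding i_def by (auto elim!: oddE evenE)
  have g: "edge_seq n p a i = a ! (i - 2) + p + 2 * i - 3" using i by (simp add: edge_seq_def)
  have "2 * n + 3 - c - 1 = 2 * (n + 1 - i) + (if odd c then 1 else 0)"
    by (subst ci) (use i in auto)
  then have "(2 * n + 3 - c - 1) div 2 = n + 1 - i" by (simp split: if_splits)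
  then have "n - 1 - (2 * n + 3 - c - 1) div 2 = i - 2" using i by auto
  moreover have "2 * n + 3 - c \<in> {1..2 * n}" using c False by auto
  ultimately have "part (doubled_shape p a) (2 * n + 3 - c) = a ! (i - 2) + p - 2"
    by (simp add: part_doubled_shape[OF len])
  moreover define t where "t = edge_seq n p a i"
  have "t \<noteq> p" "t = a ! (i - 2) + p - 2 + (2 * i - 1)"
    using i p unfolding t_def g by auto
  moreover have "edge_col p (edge_seq n p a) c = (if odd c then edge_lo p else edge_hi p) t"
    unfolding pair_col_def i_def[symmetric] t_def ..
  moreover have "c = (if odd c then 2 * i - 1 else 2 * i - 1 + 1)"
    using ci i by (auto split: if_splits)
  ultimately show ?thesis
    by (cases "odd c") (simp_all add: edge_lo_def edge_hi_def)
qed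

text \<open>
  The first row and column split off a unit.  What is left is the Jacobi-Trudi matrix with rows and
  columns in reverse order.
\<close>

lemma minor_edge_seq:
  assumes p: "2 \<le> p" and mu: "shape (2 * n + 1) (part mu)"
    and len: "length a = n" and a: "sorted a"
  shows "ldet {1..2 * (n + 1)} (\<lambda>r c. Htilde (2 * n + 1) mu r (edge_col p (edge_seq n p a) c)) =
    skew_schur (doubled_shape p a) mu"
proof -
  let ?col = "edge_col p (edge_seq n p a)"
  let ?A = "\<lambda>r c. Htilde (2 * n + 1) mu r (?col c)"
  have col1: "?col 1 = 1" by (simp add: pair_col_def edge_seq_def edge_lo_def)
  have "ldet {1..2 * (n + 1)} ?A = ldet ({1..2 * (n + 1)} - {1}) ?A"
    by (rule ldet_unit_corner) (auto simp: col1[simplified] Htilde_def bordered_def)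
  also have "{1..2 * (n + 1)} - {1} = {2..2 * n + 2}" by auto
  also have "ldet {2..2 * n + 2} ?A =
      ldet {1..2 * n + 1} (\<lambda>r c. ?A (2 * n + 3 - r) (2 * n + 3 - c))"
  proof (rule ldet_reindex)
    show "bij_betw (\<lambda>c. 2 * n + 3 - c) {1..2 * n + 1} {2..2 * n + 2}"
      by (rule bij_betwI[where g = "\<lambda>c. 2 * n + 3 - c"]) auto
  qed simp
  also have "\<dots> = ldet {1..2 * n + 1}
      (\<lambda>r c. hsym (int (part (doubled_shape p a) c) - int c - int (part mu r) + int r))"
  proof (rule ldet_cong)
    fix r c assume r: "r \<in> {1..2 * n + 1}" and c: "c \<in> {1..2 * n + 1}"
    have c': "2 * n + 3 - c \<in> {2..2 * n + 2}" "2 * n + 3 - (2 * n + 3 - c) = c" using c by auto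
    have col: "?col (2 * n + 3 - c) = part (doubled_shape p a) c + (2 * n + 3 - c)"
      using edge_col_edge_seq[OF p len c'(1)] unfolding c'(2) .
    have "?A (2 * n + 3 - r) (2 * n + 3 - c) = hsym (int (part (doubled_shape p a) c + (2 * n + 3 - c) - 1)
        - int (2 * n + 3 - r - 1) - int (part mu (2 * n + 1 + 1 - (2 * n + 3 - r - 1))))"
      unfolding col Htilde_def bordered_def Hmat_def using r c by auto
    also have "2 * n + 1 + 1 - (2 * n + 3 - r - 1) = r" using r by auto
    also have "int (part (doubled_shape p a) c + (2 * n + 3 - c) - 1) - int (2 * n + 3 - r - 1) - int (part mu r) =
        int (part (doubled_shape p a) c) - int c - int (part mu r) + int r"
      using r c by auto
    finally show "?A (2 * n + 3 - r) (2 * n + 3 - c) =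
        hsym (int (part (doubled_shape p a) c) - int c - int (part mu r) + int r)" .
  qed
  also have "\<dots> = skew_schur (doubled_shape p a) mu"
    by (rule jacobi_trudi[OF shape_doubled_shape[OF len a] mu])
  finally show ?thesis .
qed

lemma weight_edge_seq:
  "(\<Prod>i = 1..n + 1. edge_wt p (edge_seq n p a i)) = (\<Prod>r = 1..n. vvar (a ! (r - 1) + p + 2 * r - 2))"
proof -
  have "(\<Prod>i = 1..n + 1. edge_wt p (edge_seq n p a i)) =
      edge_wt p (edge_seq n p a 1) * (\<Prod>i = Suc 1..Suc n. edge_wt p (edge_seq n p a i))"
    by (subst prod.atLeast_Suc_atMost) auto
  also have "\<dots> = (\<Prod>r = 1..n. edge_wt p (edge_seq n p a (Suc r)))"
    by (subst prod.shift_bounds_cl_Suc_ivl) (simp add: edge_wt_def edge_seq_def)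
  also have "\<dots> = (\<Prod>r = 1..n. vvar (a ! (r - 1) + p + 2 * r - 2))"
  proof (rule prod.cong[OF refl])
    fix r assume r: "r \<in> {1..n}"
    then have g: "edge_seq n p a (Suc r) = a ! (r - 1) + p + 2 * r - 1"
      by (simp add: edge_seq_def numeral_2_eq_2)
    have "edge_seq n p a (Suc r) \<noteq> p" using r unfolding g by auto
    then have "edge_wt p (edge_seq n p a (Suc r)) = vvar (edge_seq n p a (Suc r) - 1)"
      by (simp add: edge_wt_def)
    also have "edge_seq n p a (Suc r) - 1 = a ! (r - 1) + p + 2 * r - 2" using r unfolding g by auto
    finally show "edge_wt p (edge_seq n p a (Suc r)) = vvar (a ! (r - 1) + p + 2 * r - 2)" .
  qed
  finally show ?thesis .
qed

text \<open>
  If the exceptional edge is missing, the first row of the minor is zero; if two consecutive edges share an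
  endpoint, the minor has two equal columns.
\<close>

lemma minor_eq_0:
  assumes p: "2 \<le> p" and g: "g \<in> {1..n + 1} \<rightarrow>\<^sub>E {p..<B}" "strict_mono_on {1..n + 1} g"
    and bad: "g 1 \<noteq> p \<or> (\<exists>i\<in>{2..n}. g (i + 1) < g i + 2)"
  shows "ldet {1..2 * (n + 1)} (\<lambda>r c. Htilde l mu r (edge_col p g c)) = 0"
proof (cases "g 1 = p")
  case False
  have gt: "g i > p" if i: "i \<in> {1..n + 1}" for i
  proof -
    have "g 1 \<le> g i" using strict_mono_onD[OF g(2), of 1 i] i by (cases "i = 1") auto
    moreover have "p \<le> g 1" using g(1) by (auto simp: PiE_iff)
    ultimately show ?thesis using False by simp
  qed
  show ?thesis
  proof (rule ldet_zero_row[of _ 1])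
    fix c assume c: "c \<in> {1..2 * (n + 1)}"
    define t where "t = g ((c + 1) div 2)"
    have "t > p" unfolding t_def by (intro gt) (use c in auto)
    then have "edge_col p g c \<noteq> 1"
      using p unfolding pair_col_def t_def[symmetric] by (simp add: edge_lo_def edge_hi_def)
    then show "Htilde l mu 1 (edge_col p g c) = 0" by (simp add: Htilde_def bordered_def)
  qed auto
next
  case True
  with bad obtain i where i: "i \<in> {2..n}" "g (i + 1) < g i + 2" by auto
  have "p < g i" "g i < g (i + 1)"
    using strict_mono_onD[OF g(2), of 1 i] strict_mono_onD[OF g(2), of i "i + 1"] i True by auto
  then have "edge_col p g (2 * i) = edge_col p g (2 * i + 1)"
    using i by (simp add: pair_col_def edge_lo_def edge_hi_def)
  then show ?thesis using i by (intro ldet_equal_columns[of _ "2 * i" "2 * i + 1"]) auto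
qed

text \<open>
  The number \<open>p + 2 * r + 1\<close> subtracted by the inverse map is the least possible value of
  \<open>g (r + 2)\<close>: \<open>g 2\<close> exceeds \<open>p\<close>, and each later step is at least 2.
\<close>

lemma edge_seq_bij:
  assumes B: "p < B"
  shows "bij_betw (edge_seq n p) {a. length a = n \<and> sorted a \<and> (\<forall>r<n. a ! r + p + 2 * r + 1 < B)}
    {g. g \<in> {1..n + 1} \<rightarrow>\<^sub>E {p..<B} \<and> strict_mono_on {1..n + 1} g \<and>
        g 1 = p \<and> (\<forall>i\<in>{2..n}. g i + 2 \<le> g (i + 1))}"
    (is "bij_betw _ ?A ?G")
proof (rule bij_betwI[where g = "\<lambda>g. map (\<lambda>r. g (r + 2) - (p + 2 * r + 1)) [0..<n]"])
  have val: "edge_seq n p a (r + 2) = a ! r + p + 2 * r + 1" if "r < n" for a r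
    using that by (simp add: edge_seq_def)
  have first: "edge_seq n p a 1 = p" for a by (simp add: edge_seq_def)
  show "edge_seq n p \<in> ?A \<rightarrow> ?G"
  proof
    fix a assume "a \<in> ?A"
    then have len: "length a = n" and a: "sorted a" and bd: "\<And>r. r < n \<Longrightarrow> a ! r + p + 2 * r + 1 < B"
      by auto
    have "edge_seq n p a i \<in> {p..<B}" if i: "i \<in> {1..n + 1}" for i
    proof (cases "i = 1")
      case False
      then have "i = (i - 2) + 2" "i - 2 < n" using i by auto
      then show ?thesis using val[of "i - 2" a] bd[of "i - 2"] by auto
    qed (simp add: edge_seq_def B)
    moreover have "edge_seq n p a i = undefined" if "i \<notin> {1..n + 1}" for i
      using that by (auto simp: edge_seq_def)
    moreover have "strict_mono_on {1..n + 1} (edge_seq n p a)"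
    proof (rule strict_mono_onI)
      fix i j assume ij: "i \<in> {1..n + 1}" "j \<in> {1..n + 1}" "i < j"
      then obtain s where j: "j = s + 2" "s < n" by (auto intro: that[of "j - 2"])
      show "edge_seq n p a i < edge_seq n p a j"
      proof (cases "i = 1")
        case True
        then show ?thesis unfolding True first j(1) val[OF j(2)] by simp
      next
        case False
        then obtain r where i: "i = r + 2" "r < n" using ij by (auto intro: that[of "i - 2"])
        have "a ! r \<le> a ! s" using ij len i j by (intro sorted_nth_mono[OF a]) auto
        then show ?thesis using ij unfolding i(1) j(1) val[OF i(2)] val[OF j(2)] by simp
      qed
    qed
    moreover have "edge_seq n p a i + 2 \<le> edge_seq n p a (i + 1)" if i: "i \<in> {2..n}" for i
    proof -
      obtain r where r: "i = r + 2" "r + 1 < n" using i by (auto intro: that[of "i - 2"])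
      have "a ! r \<le> a ! (r + 1)" using r len by (intro sorted_nth_mono[OF a]) auto
      then show ?thesis using val[of r a] val[of "r + 1" a] r by simp
    qed
    ultimately show "edge_seq n p a \<in> ?G" by (auto simp: PiE_iff extensional_def edge_seq_def)
  qed
  show "(\<lambda>g. map (\<lambda>r. g (r + 2) - (p + 2 * r + 1)) [0..<n]) \<in> ?G \<rightarrow> ?A" and
    "\<And>g. g \<in> ?G \<Longrightarrow> edge_seq n p (map (\<lambda>r. g (r + 2) - (p + 2 * r + 1)) [0..<n]) = g"
  proof -
    have *: "map (\<lambda>r. g (r + 2) - (p + 2 * r + 1)) [0..<n] \<in> ?A \<and>
        edge_seq n p (map (\<lambda>r. g (r + 2) - (p + 2 * r + 1)) [0..<n]) = g" if "g \<in> ?G" for g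
    proof -
      have g: "g \<in> {1..n + 1} \<rightarrow>\<^sub>E {p..<B}" "strict_mono_on {1..n + 1} g" "g 1 = p"
          "\<And>i. i \<in> {2..n} \<Longrightarrow> g i + 2 \<le> g (i + 1)"
        using that by auto
      let ?a = "map (\<lambda>r. g (r + 2) - (p + 2 * r + 1)) [0..<n]"
      have low: "p + 2 * r + 1 \<le> g (r + 2)" if "r < n" for r
        using that
      proof (induction r)
        case 0
        then show ?case using strict_mono_onD[OF g(2), of 1 2] g(3) by (simp add: numeral_2_eq_2)
      next
        case (Suc r)
        then show ?case using g(4)[of "r + 2"] by simp
      qed
      have nth: "?a ! r + p + 2 * r + 1 = g (r + 2)" if "r < n" for r
        using low[OF that] that by simp
      have "sorted ?a"
        unfolding sorted_iff_nth_Suc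
      proof (intro allI impI)
        fix r assume r: "Suc r < length ?a"
        then show "?a ! r \<le> ?a ! Suc r"
          using g(4)[of "r + 2"] low[of r] by simp
      qed
      moreover have "g (r + 2) < B" if "r < n" for r using g(1) that by (auto simp: PiE_iff)
      ultimately have "?a \<in> ?A" using nth by simp
      moreover have "edge_seq n p ?a i = g i" for i
      proof -
        consider "i = 1" | r where "i = r + 2" "r < n" | "i \<notin> {1..n + 1}"
        proof -
          assume "i = 1 \<Longrightarrow> thesis" "\<And>r. i = r + 2 \<Longrightarrow> r < n \<Longrightarrow> thesis" "i \<notin> {1..n + 1} \<Longrightarrow> thesis"
          moreover have "i = (i - 2) + 2 \<and> i - 2 < n" if "i \<in> {1..n + 1}" "i \<noteq> 1" using that by auto
          ultimately show thesis by blast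
        qed
        then show ?thesis
        proof cases
          case 1
          then show ?thesis using g(3) by (simp add: edge_seq_def)
        next
          case (2 r)
          then show ?thesis using nth[of r] val[of r ?a] by simp
        next
          case 3
          then have "edge_seq n p ?a i = undefined" by (auto simp: edge_seq_def)
          then show ?thesis using PiE_arb[OF g(1) 3] by simp
        qed
      qed
      ultimately show ?thesis by blast
    qed
    then show "(\<lambda>g. map (\<lambda>r. g (r + 2) - (p + 2 * r + 1)) [0..<n]) \<in> ?G \<rightarrow> ?A" by blast
    show "\<And>g. g \<in> ?G \<Longrightarrow> edge_seq n p (map (\<lambda>r. g (r + 2) - (p + 2 * r + 1)) [0..<n]) = g"
      using * by blast
  qed
  fix a assume "a \<in> ?A"
  then show "map (\<lambda>r. edge_seq n p a (r + 2) - (p + 2 * r + 1)) [0..<n] = a"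
    by (intro nth_equalityI) (auto simp: val simp del: add_2_eq_Suc')
qed

theorem theorem3p5:
  fixes n p :: nat and mu :: "nat list"
  assumes "2 \<le> p" and "is_partition mu" and "plen mu \<le> 2 * n + 1"
  shows "Pf (n + 1) (imat_mult (imat_mult (Htilde (2 * n + 1) mu) (Omega_tilde p))
                               (imat_transpose (Htilde (2 * n + 1) mu)))
       = msum (\<lambda>a. skew_schur (doubled_shape p a) mu * (\<Prod>r = 1..n. vvar (a ! (r - 1) + p + 2 * r - 2)))
              {a. length a = n \<and> sorted a}"
proof (rule mfps_eqI)
  fix m :: "nat \<Rightarrow>\<^sub>0 nat"
  note p = assms(1)
  let ?H = "Htilde (2 * n + 1) mu"
  let ?t = "\<lambda>a. skew_schur (doubled_shape p a) mu * (\<Prod>r = 1..n. vvar (a ! (r - 1) + p + 2 * r - 2))"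
  let ?F = "{a \<in> {a. length a = n \<and> sorted a}. mcoeff (?t a) m \<noteq> 0}"
  have "finite (\<Union>a\<in>?F. set a)" using finite_skew_schur_sum[OF p] by (intro finite_UN_I) auto
  then obtain b where b: "\<And>a x. a \<in> ?F \<Longrightarrow> x \<in> set a \<Longrightarrow> x < b"
    unfolding finite_nat_set_iff_bounded by blast
  \<comment> \<open>Large enough for the entries beyond column \<open>B\<close> to vanish at \<open>m\<close>, and for the edges below \<open>B\<close> to
     cover all sequences \<open>a\<close> that contribute to the coefficient at \<open>m\<close>.\<close>
  define B where "B = p + 2 * n + 2 + b + mdeg m + sum_list mu"
  have pB: "p < B" by (simp add: B_def)
  let ?A = "{a. length a = n \<and> sorted a \<and> (\<forall>r<n. a ! r + p + 2 * r + 1 < B)}"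
  let ?E = "{1..n + 1} \<rightarrow>\<^sub>E {p..<B}"
  let ?\<Phi> = "\<lambda>g. (\<Prod>i = 1..n + 1. edge_wt p (g i)) * ldet {1..2 * (n + 1)} (\<lambda>r c. ?H r (edge_col p g c))"
  have van: "agree m (?H c l) 0" if "c \<in> {1..2 * (n + 1)}" "l > B" for c l
    using that by (intro Htilde_vanishes) (auto simp: B_def)
  have "mcoeff (Pf (n + 1) (imat_mult (imat_mult ?H (Omega_tilde p)) (imat_transpose ?H))) m =
      mcoeff (Pf (n + 1) (\<lambda>c d. \<Sum>t\<in>{p..<B}. edge_wt p t *
        (?H c (edge_lo p t) * ?H d (edge_hi p t) - ?H c (edge_hi p t) * ?H d (edge_lo p t)))) m"
    by (intro agree_mcoeff agree_Pf agree_product_entry p pB van)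
  also have "\<dots> = mcoeff (\<Sum>g | g \<in> ?E \<and> strict_mono_on {1..n + 1} g. ?\<Phi> g) m"
    by (subst Pf_minor_sum) simp_all
  also have "(\<Sum>g | g \<in> ?E \<and> strict_mono_on {1..n + 1} g. ?\<Phi> g) =
      (\<Sum>g | g \<in> ?E \<and> strict_mono_on {1..n + 1} g \<and> g 1 = p \<and> (\<forall>i\<in>{2..n}. g i + 2 \<le> g (i + 1)). ?\<Phi> g)"
  proof (rule sum.mono_neutral_right)
    show "finite {g. g \<in> ?E \<and> strict_mono_on {1..n + 1} g}"
      by (rule finite_subset[of _ ?E]) (auto intro: finite_PiE)
    show "\<forall>g\<in>{g. g \<in> ?E \<and> strict_mono_on {1..n + 1} g} - {g. g \<in> ?E \<and> strict_mono_on {1..n + 1} g \<and>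
        g 1 = p \<and> (\<forall>i\<in>{2..n}. g i + 2 \<le> g (i + 1))}. ?\<Phi> g = 0"
    proof
      fix g assume "g \<in> {g. g \<in> ?E \<and> strict_mono_on {1..n + 1} g} - {g. g \<in> ?E \<and>
        strict_mono_on {1..n + 1} g \<and> g 1 = p \<and> (\<forall>i\<in>{2..n}. g i + 2 \<le> g (i + 1))}"
      then have g: "g \<in> ?E" "strict_mono_on {1..n + 1} g"
          "g 1 \<noteq> p \<or> (\<exists>i\<in>{2..n}. g (i + 1) < g i + 2)"
        by (auto simp only: mem_Collect_eq Diff_iff not_le simp_thms)
      show "?\<Phi> g = 0" unfolding minor_eq_0[OF p g] by simp
    qed
  qed blast
  also have "\<dots> = (\<Sum>a\<in>?A. ?\<Phi> (edge_seq n p a))"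
    by (rule sum.reindex_bij_betw[OF edge_seq_bij[OF pB], symmetric])
  also have "\<dots> = (\<Sum>a\<in>?A. ?t a)"
  proof (rule sum.cong[OF refl])
    fix a assume "a \<in> ?A"
    then have a: "length a = n" "sorted a" by auto
    show "?\<Phi> (edge_seq n p a) = ?t a"
      unfolding weight_edge_seq minor_edge_seq[OF p shape_part[OF assms(2,3)] a] by (rule mult.commute)
  qed
  also have "mcoeff (\<Sum>a\<in>?A. ?t a) m = mcoeff (msum ?t {a. length a = n \<and> sorted a}) m"
    unfolding mcoeff_sum
  proof (rule mcoeff_msum[symmetric])
    have "?A \<subseteq> {a. set a \<subseteq> {..<B} \<and> length a = n}"
    proof
      fix a assume "a \<in> ?A"
      then have len: "length a = n" and bd: "\<And>r. r < n \<Longrightarrow> a ! r + p + 2 * r + 1 < B" by auto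
      have "x < B" if x: "x \<in> set a" for x
      proof -
        obtain r where r: "r < n" "x = a ! r" using x len by (metis in_set_conv_nth)
        show ?thesis using bd[OF r(1)] unfolding r(2) by simp
      qed
      then show "a \<in> {a. set a \<subseteq> {..<B} \<and> length a = n}" using len by auto
    qed
    then show "finite ?A" by (rule finite_subset) (simp add: finite_lists_length_eq)
    fix a assume a: "a \<in> {a. length a = n \<and> sorted a}" "mcoeff (?t a) m \<noteq> 0"
    then have F: "a \<in> ?F" by blast
    have "a ! r + p + 2 * r + 1 < B" if "r < n" for r
    proof -
      have "a ! r \<in> set a" using a(1) that by auto
      then have "a ! r < b" by (rule b[OF F])
      then show ?thesis using that by (simp add: B_def)
    qed
    then show "a \<in> ?A" using a by auto
  qed auto
  finally show "mcoeff (Pf (n + 1) (imat_mult (imat_mult ?H (Omega_tilde p)) (imat_transpose ?H))) m =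
      mcoeff (msum ?t {a. length a = n \<and> sorted a}) m" .
qed

end
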